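(* Let $k\ge 1$, let $\mathbf{A}\in\mathbb{R}^{n\times d}$ be a matrix of rank at least $k$, let $0<\epsilon<\tfrac14$, and let $\mathbf{C}$ be the column submatrix of $\mathbf{A}$ selected by the deterministic ridge leverage score (DRLS) algorithm with parameters $k$ and $\epsilon$. Then $$\|\mathbf{A}-\mathbf{C}\mathbf{C}^+\mathbf{A}\|_F^2\;\le\;\|\mathbf{A}-\boldsymbol{\Pi}^F_{\mathbf{C},k}(\mathbf{A})\|_F^2\;\le\;(1+4\epsilon)\,\|\mathbf{A}_{\backslash k}\|_F^2,$$ where $\boldsymbol{\Pi}^F_{\mathbf{C},k}(\mathbf{A})=(\mathbf{C}\mathbf{C}^+\mathbf{A})_k$ is the best rank-$k$ approximation to $\mathbf{A}$ in the column space of $\mathbf{C}$ with respect to the Frobenius norm.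
   Context: Notation. $\|\cdot\|_F$ is the Frobenius norm; $\mathbf{M}^+$ is the Moore-Penrose pseudoinverse. For a matrix $\mathbf{M}$, $\mathbf{M}_k$ is its rank-$k$ truncated SVD approximation (keeping the $k$ largest singular values with their singular vectors) and $\mathbf{M}_{\backslash k}=\mathbf{M}-\mathbf{M}_k$. Ridge leverage scores. For $\mathbf{A}\in\mathbb{R}^{n\times d}$ with columns $\mathbf{a}_1,\dots,\mathbf{a}_d$, $$\bar\tau_i(\mathbf{A})=\mathbf{a}_i^T\left(\mathbf{A}\mathbf{A}^T+\tfrac1k\|\mathbf{A}_{\backslash k}\|_F^2\,\mathbf{I}\right)^+\mathbf{a}_i,\qquad \bar t=\sum_{i=1}^d\bar\tau_i(\mathbf{A}).$$ DRLS algorithm (parameters $k$, error tolerance $\epsilon>0$). Sort the columns by $\bar\tau_i(\mathbf{A})$ from largest to smallest (ties broken arbitrarily). Starting from the empty set $\Theta$, add column indices to $\Theta$ in this order until $\sum_{i\in\Theta}\bar\tau_i(\mathbf{A})>\bar t-\epsilon$, and then stop. If $|\Theta|<k$, continue adding indices in the same order until $|\Theta|=k$. The output $\mathbf{C}\in\mathbb{R}^{n\times|\Theta|}$ is the submatrix of $\mathbf{A}$ consisting of the (unweighted) columns indexed by $\Theta$; equivalently $\mathbf{C}=\mathbf{A}\mathbf{S}$ with $\mathbf{S}$ the corresponding $d\times|\Theta|$ 0-1 column selection matrix. *)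

theory Defs
  imports Complex_Main "Jordan_Normal_Form.DL_Rank"
begin

definition frob_norm :: "real mat \<Rightarrow> real" where
  "frob_norm M = sqrt (\<Sum>i<dim_row M. \<Sum>j<dim_col M. (M $$ (i, j))\<^sup>2)"

definition is_pinv :: "real mat \<Rightarrow> real mat \<Rightarrow> bool" where
  "is_pinv M X \<longleftrightarrow>
     X \<in> carrier_mat (dim_col M) (dim_row M) \<and>
     M * X * M = M \<and> X * M * X = X \<and>
     (M * X)\<^sup>T = M * X \<and> (X * M)\<^sup>T = X * M"

text \<open>The four Penrose conditions have exactly one solution for every real matrix,
  so the definite description is always meaningful.\<close>

definition pinv :: "real mat \<Rightarrow> real mat" where
  "pinv M = (THE X. is_pinv M X)"

definition rect_diag :: "nat \<Rightarrow> nat \<Rightarrow> (nat \<Rightarrow> real) \<Rightarrow> real mat" where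
  "rect_diag n d \<sigma> = mat n d (\<lambda>(i, j). if i = j then \<sigma> i else 0)"

definition is_orthogonal_mat :: "nat \<Rightarrow> real mat \<Rightarrow> bool" where
  "is_orthogonal_mat n U \<longleftrightarrow> U \<in> carrier_mat n n \<and> U\<^sup>T * U = 1\<^sub>m n \<and> U * U\<^sup>T = 1\<^sub>m n"

text \<open>Full singular value decomposition \<open>M = U \<Sigma> V\<^sup>T\<close>; \<open>\<sigma>\<close> is indexed from 0, and only its
  values below \<open>min n d\<close> matter.\<close>

definition is_svd :: "real mat \<Rightarrow> real mat \<Rightarrow> (nat \<Rightarrow> real) \<Rightarrow> real mat \<Rightarrow> bool" where
  "is_svd M U \<sigma> V \<longleftrightarrow>
     is_orthogonal_mat (dim_row M) U \<and> is_orthogonal_mat (dim_col M) V \<and>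
     (\<forall>i < min (dim_row M) (dim_col M). 0 \<le> \<sigma> i) \<and>
     (\<forall>i j. i \<le> j \<and> j < min (dim_row M) (dim_col M) \<longrightarrow> \<sigma> j \<le> \<sigma> i) \<and>
     M = U * rect_diag (dim_row M) (dim_col M) \<sigma> * V\<^sup>T"

text \<open>The rank-\<open>k\<close> truncation \<open>M\<^sub>k\<close> depends on the chosen decomposition when the \<open>k\<close>-th and
  \<open>(k+1)\<close>-st singular values coincide, hence a relation. The Frobenius norm of \<open>M - M\<^sub>k\<close> does
  not depend on the choice.\<close>

definition is_svd_trunc :: "nat \<Rightarrow> real mat \<Rightarrow> real mat \<Rightarrow> bool" where
  "is_svd_trunc k M Mk \<longleftrightarrow>
     (\<exists>U \<sigma> V. is_svd M U \<sigma> V \<and>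
        Mk = U * rect_diag (dim_row M) (dim_col M) (\<lambda>i. if i < k then \<sigma> i else 0) * V\<^sup>T)"

text \<open>In the following definitions \<open>Ak\<close> is a rank-\<open>k\<close> truncation of \<open>A\<close>; columns are indexed
  from 0.\<close>

definition ridge_leverage_score :: "nat \<Rightarrow> real mat \<Rightarrow> real mat \<Rightarrow> nat \<Rightarrow> real" where
  "ridge_leverage_score k A Ak i =
     col A i \<bullet>
       (pinv (A * A\<^sup>T + ((1 / real k) * (frob_norm (A - Ak))\<^sup>2) \<cdot>\<^sub>m 1\<^sub>m (dim_row A)) *\<^sub>v col A i)"

definition total_ridge_leverage :: "nat \<Rightarrow> real mat \<Rightarrow> real mat \<Rightarrow> real" where
  "total_ridge_leverage k A Ak = (\<Sum>i<dim_col A. ridge_leverage_score k A Ak i)"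

text \<open>\<open>ord\<close> lists all column indices by decreasing score, with ties in any order. The prefix of
  length \<open>m\<close> is the selection at the time the score threshold is first exceeded; if it has fewer
  than \<open>k\<close> indices it is extended to length \<open>k\<close>.\<close>

definition is_drls_selection ::
  "nat \<Rightarrow> real \<Rightarrow> real mat \<Rightarrow> real mat \<Rightarrow> nat list \<Rightarrow> bool" where
  "is_drls_selection k \<epsilon> A Ak \<Theta> \<longleftrightarrow>
     (\<exists>ord. distinct ord \<and> set ord = {..<dim_col A} \<and>
        sorted_wrt (\<lambda>i j. ridge_leverage_score k A Ak i \<ge> ridge_leverage_score k A Ak j) ord \<and>
        (let m = (LEAST m. (\<Sum>i\<in>set (take m ord). ridge_leverage_score k A Ak i)
                             > total_ridge_leverage k A Ak - \<epsilon>)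
         in \<Theta> = (if m < k then take k ord else take m ord)))"

definition is_drls_output :: "nat \<Rightarrow> real \<Rightarrow> real mat \<Rightarrow> real mat \<Rightarrow> real mat \<Rightarrow> bool" where
  "is_drls_output k \<epsilon> A Ak C \<longleftrightarrow>
     (\<exists>\<Theta>. is_drls_selection k \<epsilon> A Ak \<Theta> \<and> C = mat_of_cols (dim_row A) (map (col A) \<Theta>))"

text \<open>Matrices of rank at most \<open>k\<close>, shaped like \<open>A\<close>, all of whose columns lie in the column
  space of \<open>C\<close>.\<close>

definition low_rank_in_colspace :: "nat \<Rightarrow> real mat \<Rightarrow> real mat \<Rightarrow> real mat set" where
  "low_rank_in_colspace k A C =
     {X \<in> carrier_mat (dim_row A) (dim_col A).
        vec_space.rank (dim_row A) X \<le> k \<and>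
        (\<forall>j<dim_col A. \<exists>w\<in>carrier_vec (dim_col C). col X j = C *\<^sub>v w)}"

definition is_best_frob_approx_in_colspace ::
  "nat \<Rightarrow> real mat \<Rightarrow> real mat \<Rightarrow> real mat \<Rightarrow> bool" where
  "is_best_frob_approx_in_colspace k A C P \<longleftrightarrow>
     is_arg_min (\<lambda>X. frob_norm (A - X)) (\<lambda>X. X \<in> low_rank_in_colspace k A C) P"

end

theory Submission
  imports Defs
begin

text \<open>
Let \<open>Q = C (pinv C)\<close> be the orthogonal projection onto the column space of \<open>C\<close>. Pythagoras and the
Eckart--Young theorem show that a rank-\<open>k\<close> truncation \<open>P\<close> of \<open>Q A\<close> is a best approximation of
\<open>A\<close> among the matrices of rank at most \<open>k\<close> with columns in the column space of \<open>C\<close>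
(\<open>best_frob_approx_in_colspace\<close>). The same splitting of the error gives the first inequality, and optimality of \<open>P\<close> permits the second one
to be proved for any competitor in place of \<open>P\<close>.

The competitor is \<open>Q Ak\<close>. Writing \<open>Ak = A H H\<^sup>T\<close> with the first \<open>k\<close> right singular vectors as
the columns of \<open>H\<close>, the errors \<open>A - Ak\<close> and \<open>Ak - Q Ak\<close> are orthogonal, so the squared error of
\<open>Q Ak\<close> exceeds that of \<open>Ak\<close> exactly by the sum of the squared lengths of the \<open>k\<close> residuals
\<open>w = (1 - Q) A h\<close>, where \<open>h\<close> is a column of \<open>H\<close> (\<open>projected_svd_trunc_error\<close>).

A single residual is short because of the choice of columns (\<open>projection_residual_bound\<close>). Let
\<open>K = A A\<^sup>T + l I\<close> be the matrix that defines the scores. Cauchy--Schwarz for \<open>K\<close> gives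
\<open>(a \<bullet> w)\<^sup>2 \<le> \<tau> (w \<bullet> K w)\<close> for a column \<open>a\<close> with score \<open>\<tau>\<close>
(\<open>ridge_score_dominates\<close>). Since \<open>w\<close> is orthogonal to the selected columns and the other scores sum
to at most \<open>\<epsilon>\<close>, summation over the columns yields
\<open>|A\<^sup>T w|\<^sup>2 \<le> \<epsilon> (|A\<^sup>T w|\<^sup>2 + l |w|\<^sup>2)\<close>. On the other hand
\<open>|w|\<^sup>2 = h \<bullet> A\<^sup>T w \<le> |A\<^sup>T w|\<close>. Hence \<open>|w|\<^sup>2 \<le> \<epsilon> l / (1 - \<epsilon>)\<close>, and the \<open>k\<close>
residuals together contribute at most \<open>\<epsilon> / (1 - \<epsilon>)\<close> times \<open>k l\<close>, where \<open>k l\<close> is the squared error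
of \<open>Ak\<close>. For \<open>\<epsilon> < 1/4\<close> the factor is below \<open>4 \<epsilon>\<close>.
\<close>

section \<open>Matrix products\<close>

text \<open>Associativity and transposition of products with side conditions on dimensions only. The simplifier
evaluates such conditions without having to guess the inner dimensions of a
\<^const>\<open>carrier_mat\<close> premise.\<close>

lemma mult_assoc_dim:
  fixes X Y Z :: "real mat"
  assumes "dim_col X = dim_row Y" "dim_col Y = dim_row Z"
  shows "X * Y * Z = X * (Y * Z)"
  using assms by (intro assoc_mult_mat[of X "dim_row X" "dim_col X" Y "dim_col Y" Z "dim_col Z"]) auto

lemma transpose_mult_dim:
  fixes X Y :: "real mat"
  assumes "dim_col X = dim_row Y"
  shows "(X * Y)\<^sup>T = Y\<^sup>T * X\<^sup>T"
  using assms by (intro transpose_mult[of X "dim_row X" "dim_col X" Y "dim_col Y"]) auto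

section \<open>The Frobenius inner product\<close>

definition frob_ip :: "real mat \<Rightarrow> real mat \<Rightarrow> real" where
  "frob_ip X Y = (\<Sum>i<dim_row X. \<Sum>j<dim_col X. X $$ (i, j) * Y $$ (i, j))"

abbreviation frob_sq :: "real mat \<Rightarrow> real" where
  "frob_sq X \<equiv> frob_ip X X"

lemma frob_norm_power2: "(frob_norm X)\<^sup>2 = frob_sq X"
  unfolding frob_norm_def frob_ip_def
  by (subst real_sqrt_pow2) (auto intro!: sum_nonneg simp: power2_eq_square)

lemma frob_norm_nonneg: "0 \<le> frob_norm X"
  by (simp add: frob_norm_def sum_nonneg)

lemma frob_sq_nonneg: "0 \<le> frob_sq X"
  by (metis frob_norm_power2 zero_le_power2)

text \<open>Transposition is the adjoint of multiplication for the inner product that induces the Frobenius norm.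
This lemma and its mirror image \<open>frob_ip_mult_right\<close> reduce invariance under isometries and
orthogonality of error terms to matrix identities.\<close>

lemma frob_ip_mult_left:
  assumes "dim_col P = dim_row X" "dim_row Y = dim_row P" "dim_col Y = dim_col X"
  shows "frob_ip (P * X) Y = frob_ip X (P\<^sup>T * Y)"
proof -
  have "frob_ip (P * X) Y =
      (\<Sum>i<dim_row P. \<Sum>j<dim_col X. \<Sum>l<dim_row X. P $$ (i, l) * X $$ (l, j) * Y $$ (i, j))"
    unfolding frob_ip_def using assms
    by (simp add: scalar_prod_def sum_distrib_right atLeast0LessThan)
  also have "\<dots> = (\<Sum>l<dim_row X. \<Sum>j<dim_col X. \<Sum>i<dim_row P. P $$ (i, l) * X $$ (l, j) * Y $$ (i, j))"
    by (subst (2) sum.swap, subst sum.swap, subst (2) sum.swap) (rule refl)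
  also have "\<dots> = frob_ip X (P\<^sup>T * Y)"
    unfolding frob_ip_def using assms
    by (simp add: scalar_prod_def sum_distrib_left atLeast0LessThan mult_ac)
  finally show ?thesis .
qed

lemma frob_ip_transpose:
  assumes "dim_row Y = dim_row X" "dim_col Y = dim_col X"
  shows "frob_ip X\<^sup>T Y\<^sup>T = frob_ip X Y"
  unfolding frob_ip_def using assms by (subst sum.swap) simp

lemma frob_ip_mult_right:
  assumes "dim_col X = dim_row P" "dim_row Y = dim_row X" "dim_col Y = dim_col P"
  shows "frob_ip (X * P) Y = frob_ip X (Y * P\<^sup>T)"
proof -
  have "frob_ip (X * P) Y = frob_ip (P\<^sup>T * X\<^sup>T) Y\<^sup>T"
    using assms frob_ip_transpose[of Y "X * P"] by (simp add: transpose_mult_dim)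
  also have "\<dots> = frob_ip X\<^sup>T (P * Y\<^sup>T)"
    using assms by (simp add: frob_ip_mult_left)
  also have "\<dots> = frob_ip X (Y * P\<^sup>T)"
    using assms frob_ip_transpose[of "Y * P\<^sup>T" X] by (simp add: transpose_mult_dim)
  finally show ?thesis .
qed

lemma frob_ip_commute:
  assumes "dim_row Y = dim_row X" "dim_col Y = dim_col X"
  shows "frob_ip X Y = frob_ip Y X"
  unfolding frob_ip_def using assms by (simp add: mult_ac)

lemma frob_sq_add:
  assumes "dim_row Y = dim_row X" "dim_col Y = dim_col X" and "frob_ip X Y = 0"
  shows "frob_sq (X + Y) = frob_sq X + frob_sq Y"
proof -
  have "frob_sq (X + Y) = frob_sq X + frob_sq Y + 2 * frob_ip X Y"
    unfolding frob_ip_def using assms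
    by (simp add: algebra_simps sum.distrib sum_distrib_left)
  then show ?thesis using assms by simp
qed

lemma frob_sq_cols: "frob_sq X = (\<Sum>j<dim_col X. col X j \<bullet> col X j)"
  unfolding frob_ip_def scalar_prod_def
  by (subst sum.swap) (simp add: atLeast0LessThan)

lemma frob_sq_isometry_left:
  assumes "W\<^sup>T * W = 1\<^sub>m (dim_row X)" "dim_col W = dim_row X"
  shows "frob_sq (W * X) = frob_sq X"
proof -
  have "frob_sq (W * X) = frob_ip X (W\<^sup>T * (W * X))"
    using assms by (simp add: frob_ip_mult_left)
  also have "W\<^sup>T * (W * X) = X"
    using assms by (simp add: mult_assoc_dim[symmetric])
  finally show ?thesis .
qed

lemma frob_sq_isometry_right:
  assumes "W\<^sup>T * W = 1\<^sub>m (dim_col X)" "dim_col W = dim_col X"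
  shows "frob_sq (X * W\<^sup>T) = frob_sq X"
  using frob_sq_isometry_left[of W "X\<^sup>T"] assms
    frob_ip_transpose[of "X * W\<^sup>T" "X * W\<^sup>T"] frob_ip_transpose[of X X]
  by (simp add: transpose_mult_dim)

section \<open>Cauchy--Schwarz for positive semidefinite forms\<close>

lemma scalar_prod_self_nonneg: "0 \<le> v \<bullet> (v :: real vec)"
  unfolding scalar_prod_def by (intro sum_nonneg) simp

lemma scalar_prod_self_eq_0:
  assumes "v \<bullet> v = 0" shows "v = 0\<^sub>v (dim_vec (v :: real vec))"
  using assms unfolding scalar_prod_def
  by (intro eq_vecI) (auto simp: sum_nonneg_eq_0_iff)

text \<open>The form is only semidefinite, so the usual choice of scalars has to be complemented by an argument
for a null vector \<open>y\<close> of the form: there the values of the form on \<open>x + t y\<close> are affine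
in \<open>t\<close> and bounded below, which forces the mixed term to vanish.\<close>

lemma psd_Cauchy_Schwarz:
  fixes K :: "real mat"
  assumes K: "K \<in> carrier_mat n n" and sym: "K\<^sup>T = K"
    and psd: "\<And>v. v \<in> carrier_vec n \<Longrightarrow> 0 \<le> v \<bullet> (K *\<^sub>v v)"
    and x: "x \<in> carrier_vec n" and y: "y \<in> carrier_vec n"
  shows "(x \<bullet> (K *\<^sub>v y))\<^sup>2 \<le> (x \<bullet> (K *\<^sub>v x)) * (y \<bullet> (K *\<^sub>v y))"
proof -
  define p q r where "p = x \<bullet> (K *\<^sub>v x)" and "q = x \<bullet> (K *\<^sub>v y)" and "r = y \<bullet> (K *\<^sub>v y)"
  have Kx: "K *\<^sub>v x \<in> carrier_vec n" and Ky: "K *\<^sub>v y \<in> carrier_vec n"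
    using K x y by auto
  have q': "y \<bullet> (K *\<^sub>v x) = q"
    using transpose_vec_mult_scalar[OF K x y] sym comm_scalar_prod[OF Ky x] by (simp add: q_def)
  have form: "0 \<le> s\<^sup>2 * p + 2 * s * t * q + t\<^sup>2 * r" for s t
  proof -
    have "0 \<le> (s \<cdot>\<^sub>v x + t \<cdot>\<^sub>v y) \<bullet> (K *\<^sub>v (s \<cdot>\<^sub>v x + t \<cdot>\<^sub>v y))"
      using x y by (intro psd) auto
    also have "\<dots> = s\<^sup>2 * p + 2 * s * t * q + t\<^sup>2 * r"
    proof -
      have 1: "K *\<^sub>v (s \<cdot>\<^sub>v x + t \<cdot>\<^sub>v y) = s \<cdot>\<^sub>v (K *\<^sub>v x) + t \<cdot>\<^sub>v (K *\<^sub>v y)"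
        using K x y by (simp add: mult_add_distrib_mat_vec[OF K] mult_mat_vec[OF K])
      have "(s \<cdot>\<^sub>v x + t \<cdot>\<^sub>v y) \<bullet> (s \<cdot>\<^sub>v (K *\<^sub>v x) + t \<cdot>\<^sub>v (K *\<^sub>v y))
        = s * (s * p + t * q) + t * (s * q + t * r)"
        using x y Kx Ky
        by (simp only: add_scalar_prod_distrib[of _ n] scalar_prod_add_distrib[of _ n]
          smult_carrier_vec add_carrier_vec smult_scalar_prod_distrib[of _ n]
          scalar_prod_smult_distrib[of _ n] p_def[symmetric] q_def[symmetric] r_def[symmetric] q')
      then show ?thesis unfolding 1 by (simp only: power2_eq_square) (simp add: algebra_simps)
    qed
    finally show ?thesis .
  qed
  show ?thesis
  proof (cases "r = 0")
    case False
    have "0 \<le> r" using psd[OF y] by (simp add: r_def)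
    with False have "r > 0" by simp
    have "0 \<le> r * (p * r - q\<^sup>2)"
      using form[of r "- q"] by (simp add: power2_eq_square algebra_simps)
    then show ?thesis using \<open>r > 0\<close>
      by (simp add: p_def q_def r_def zero_le_mult_iff)
  next
    case True
    have "q = 0"
    proof (rule ccontr)
      assume "q \<noteq> 0"
      \<comment> \<open>The scalar is chosen so that the affine function \<open>p + 2 t q\<close> takes the value \<open>-1\<close>.\<close>
      have "0 \<le> p + 2 * (- (p + 1) / (2 * q)) * q" using form[of 1 "- (p + 1) / (2 * q)"] True by simp
      also have "\<dots> = -1" using \<open>q \<noteq> 0\<close> by (simp add: field_simps)
      finally show False by simp
    qed
    then show ?thesis using True by (simp add: p_def q_def r_def)
  qed
qed


section \<open>Orthogonal projections onto column spaces\<close>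

lemma smult_zero_vec: "s \<cdot>\<^sub>v 0\<^sub>v n = (0\<^sub>v n :: real vec)"
  by (intro eq_vecI) auto

definition outer_prod :: "real vec \<Rightarrow> real vec \<Rightarrow> real mat" where
  "outer_prod x y = mat (dim_vec x) (dim_vec y) (\<lambda>(i, j). x $ i * y $ j)"

lemma outer_prod_dim [simp]:
  "dim_row (outer_prod x y) = dim_vec x" "dim_col (outer_prod x y) = dim_vec y"
  by (simp_all add: outer_prod_def)

lemma outer_prod_transpose [simp]: "(outer_prod x y)\<^sup>T = outer_prod y x"
  by (intro eq_matI) (auto simp: outer_prod_def)

lemma outer_prod_mult_vec:
  assumes "dim_vec y = dim_vec v"
  shows "outer_prod x y *\<^sub>v v = (y \<bullet> v) \<cdot>\<^sub>v x"
  using assms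
  by (intro eq_vecI) (auto simp: outer_prod_def scalar_prod_def sum_distrib_left mult_ac)

lemma mult_outer_prod:
  assumes "dim_col M = dim_vec x"
  shows "M * outer_prod x y = outer_prod (M *\<^sub>v x) y"
  using assms
  by (intro eq_matI) (auto simp: outer_prod_def scalar_prod_def sum_distrib_left mult_ac)

lemma outer_prod_mult:
  assumes "dim_row M = dim_vec y"
  shows "outer_prod x y * M = outer_prod x (M\<^sup>T *\<^sub>v y)"
  using assms
  by (intro eq_matI) (auto simp: outer_prod_def scalar_prod_def sum_distrib_left mult_ac)

lemma outer_prod_zero_left: "outer_prod (0\<^sub>v n) y = 0\<^sub>m n (dim_vec y)"
  by (intro eq_matI) (auto simp: outer_prod_def)

lemma frob_sq_outer_prod: "frob_sq (outer_prod x y) = (x \<bullet> x) * (y \<bullet> y)"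
  unfolding frob_ip_def
  by (simp add: outer_prod_def scalar_prod_def sum_product atLeast0LessThan mult_ac)

definition is_orth_proj :: "real mat \<Rightarrow> bool" where
  "is_orth_proj Q \<longleftrightarrow> Q\<^sup>T = Q \<and> Q * Q = Q"

lemma orth_proj_square: "is_orth_proj Q \<Longrightarrow> dim_row Q = dim_col Q"
  unfolding is_orth_proj_def by (metis index_transpose_mat(2))

text \<open>One Gram--Schmidt step: \<open>u\<close> is the normalized component of \<open>c\<close> orthogonal to the range of
\<open>Q\<close>. If \<open>c\<close> already lies in that range, then \<open>u\<close> is the zero vector, because division by
zero yields zero, and \<open>Q\<close> is unchanged. The squared Frobenius norm of an orthogonal projection is its
rank, so the last property bounds the growth of the rank.\<close>

lemma orth_proj_extend:
  assumes Q: "Q \<in> carrier_mat n n" "is_orth_proj Q"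
    and c: "c \<in> carrier_vec n"
  obtains u where "u \<in> carrier_vec n" "\<exists>s. u = s \<cdot>\<^sub>v (c - Q *\<^sub>v c)"
    "Q *\<^sub>v u = 0\<^sub>v n"
    "is_orth_proj (Q + outer_prod u u)"
    "(Q + outer_prod u u) *\<^sub>v c = c"
    "frob_sq (Q + outer_prod u u) \<le> frob_sq Q + 1"
proof -
  define r where "r = c - Q *\<^sub>v c"
  define u where "u = (1 / sqrt (r \<bullet> r)) \<cdot>\<^sub>v r"
  have QT: "Q\<^sup>T = Q" and QQ: "Q * Q = Q" using Q(2) by (auto simp: is_orth_proj_def)
  have Qc: "Q *\<^sub>v c \<in> carrier_vec n" using Q c by simp
  have r: "r \<in> carrier_vec n" using c Qc by (simp add: r_def)
  have u: "u \<in> carrier_vec n" using r by (simp add: u_def)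
  have QQc: "Q *\<^sub>v (Q *\<^sub>v c) = Q *\<^sub>v c"
    using assoc_mult_mat_vec[OF Q(1) Q(1) c] QQ by simp
  have Qr: "Q *\<^sub>v r = 0\<^sub>v n"
    using Q c Qc by (simp add: r_def mult_minus_distrib_mat_vec[OF Q(1) c Qc] QQc)
  have Qu: "Q *\<^sub>v u = 0\<^sub>v n"
    using r Qr by (simp add: u_def mult_mat_vec[OF Q(1)] smult_zero_vec)
  have uu: "u \<bullet> u = (if r = 0\<^sub>v n then 0 else 1)"
  proof (cases "r = 0\<^sub>v n")
    case False
    then have "r \<bullet> r > 0"
      using scalar_prod_self_nonneg[of r] scalar_prod_self_eq_0[of r] r by fastforce
    then show ?thesis using False r by (simp add: u_def)
  qed (simp add: u_def)
  have u0: "r = 0\<^sub>v n \<Longrightarrow> u = 0\<^sub>v n" by (simp add: u_def smult_zero_vec)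
  have uuu: "outer_prod u u * outer_prod u u = outer_prod u u"
  proof (cases "r = 0\<^sub>v n")
    case True
    then show ?thesis using u0 by (simp add: outer_prod_zero_left)
  next
    case False
    then show ?thesis using u uu by (simp add: mult_outer_prod outer_prod_mult_vec)
  qed
  have Qo: "Q * outer_prod u u = 0\<^sub>m n n"
    using Q u by (simp add: mult_outer_prod Qu outer_prod_zero_left)
  have oQ: "outer_prod u u * Q = 0\<^sub>m n n"
    using Q u by (simp add: outer_prod_mult QT Qu)
      (intro eq_matI, auto simp: outer_prod_def)
  have o: "outer_prod u u \<in> carrier_mat n n" using u by (intro carrier_matI) auto
  have "is_orth_proj (Q + outer_prod u u)"
    unfolding is_orth_proj_def
  proof
    show "(Q + outer_prod u u)\<^sup>T = Q + outer_prod u u"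
      using transpose_add[OF Q(1) o] QT by simp
    show "(Q + outer_prod u u) * (Q + outer_prod u u) = Q + outer_prod u u"
      using Q o by (simp add: add_mult_distrib_mat[of _ n n] mult_add_distrib_mat[of _ n n]
          QQ Qo oQ uuu)
  qed
  moreover have "(Q + outer_prod u u) *\<^sub>v c = c"
  proof -
    have "r \<bullet> c = r \<bullet> r"
    proof -
      have "r \<bullet> (Q *\<^sub>v c) = (Q *\<^sub>v r) \<bullet> c"
        using transpose_vec_mult_scalar[OF Q(1) c r] QT by simp
      then have "r \<bullet> (Q *\<^sub>v c) = 0" using Qr c by simp
      moreover have "r \<bullet> r = r \<bullet> c - r \<bullet> (Q *\<^sub>v c)"
        using scalar_prod_minus_distrib[OF r c Qc] by (simp add: r_def)
      ultimately show ?thesis by simp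
    qed
    have "(u \<bullet> c) \<cdot>\<^sub>v u = r"
    proof (cases "r = 0\<^sub>v n")
      case True
      then show ?thesis using u0 by (simp add: smult_zero_vec)
    next
      case False
      then have "r \<bullet> r > 0"
        using scalar_prod_self_nonneg[of r] scalar_prod_self_eq_0[of r] r by fastforce
      then show ?thesis using r c \<open>r \<bullet> c = r \<bullet> r\<close>
        by (simp add: u_def smult_smult_assoc)
    qed
    then show ?thesis
      using c Qc u by (simp add: add_mult_distrib_mat_vec[OF Q(1) o c] outer_prod_mult_vec)
        (use c Qc Q in \<open>auto simp: r_def intro!: eq_vecI\<close>)
  qed
  moreover have "frob_sq (Q + outer_prod u u) \<le> frob_sq Q + 1"
  proof -
    have "frob_ip Q (outer_prod u u) = frob_ip (Q * Q) (outer_prod u u)" using QQ by simp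
    also have "\<dots> = frob_ip Q (Q * outer_prod u u)"
      using Q u by (simp add: frob_ip_mult_left QT)
    also have "\<dots> = 0" using Q by (simp add: Qo frob_ip_def)
    finally have "frob_sq (Q + outer_prod u u) = frob_sq Q + (u \<bullet> u) * (u \<bullet> u)"
      using Q u by (simp add: frob_sq_add frob_sq_outer_prod)
    then show ?thesis using uu by (simp split: if_splits)
  qed
  moreover have "\<exists>s. u = s \<cdot>\<^sub>v (c - Q *\<^sub>v c)" unfolding u_def r_def by blast
  ultimately show ?thesis using u Qu by (intro that[of u])
qed

text \<open>The orthogonal projection onto the column space of \<open>M\<close> arises by letting the columns of
\<open>M\<close> enter one after the other. The factor \<open>Y\<close> records that the range of the projection stays inside
the column space; it is also what pseudoinverses are assembled from.\<close>

lemma orth_proj_column_space: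
  fixes M :: "real mat"
  assumes M: "M \<in> carrier_mat n m"
  obtains Q Y where "Q \<in> carrier_mat n n" "Y \<in> carrier_mat m n" "is_orth_proj Q"
    "Q = M * Y" "Q * M = M" "frob_sq Q \<le> real m"
proof -
  have "\<exists>Q Y. Q \<in> carrier_mat n n \<and> Y \<in> carrier_mat m n \<and> is_orth_proj Q \<and> Q = M * Y \<and>
      (\<forall>j<l. Q *\<^sub>v col M j = col M j) \<and> frob_sq Q \<le> real l" if "l \<le> m" for l
    using that
  proof (induction l)
    case 0
    have "M * 0\<^sub>m m n = 0\<^sub>m n n" using M by simp
    then show ?case
      by (intro exI[of _ "0\<^sub>m n n"] exI[of _ "0\<^sub>m m n"])
        (auto simp: is_orth_proj_def frob_ip_def)
  next
    case (Suc l)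
    then obtain Q Y where Q: "Q \<in> carrier_mat n n" "is_orth_proj Q" and Y: "Y \<in> carrier_mat m n"
      and QY: "Q = M * Y" and fixed: "\<And>j. j < l \<Longrightarrow> Q *\<^sub>v col M j = col M j"
      and sq: "frob_sq Q \<le> real l"
      by auto
    define c where "c = col M l"
    have l: "l < m" using Suc.prems by simp
    have c: "c \<in> carrier_vec n" using M l by (simp add: c_def)
    obtain u s where u: "u \<in> carrier_vec n" and us: "u = s \<cdot>\<^sub>v (c - Q *\<^sub>v c)"
      and Qu: "Q *\<^sub>v u = 0\<^sub>v n" and proj: "is_orth_proj (Q + outer_prod u u)"
      and uc: "(Q + outer_prod u u) *\<^sub>v c = c"
      and sq': "frob_sq (Q + outer_prod u u) \<le> frob_sq Q + 1"
      using orth_proj_extend[OF Q c] by metis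
    define y where "y = s \<cdot>\<^sub>v (unit_vec m l - Y *\<^sub>v c)"
    have y: "y \<in> carrier_vec m" using Y c by (simp add: y_def)
    have Yc: "Y *\<^sub>v c \<in> carrier_vec m" using Y c by simp
    have "M *\<^sub>v unit_vec m l = c"
      using M l by (intro eq_vecI) (auto simp: c_def)
    moreover have "Q *\<^sub>v c = M *\<^sub>v (Y *\<^sub>v c)"
      unfolding QY using M Y c by (rule assoc_mult_mat_vec)
    moreover have "M *\<^sub>v y = s \<cdot>\<^sub>v (M *\<^sub>v unit_vec m l - M *\<^sub>v (Y *\<^sub>v c))"
      unfolding y_def using Yc
      by (simp only: mult_mat_vec[OF M] mult_minus_distrib_mat_vec[OF M _ Yc] minus_carrier_vec
          unit_vec_carrier)
    ultimately have uy: "u = M *\<^sub>v y" using us by simp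
    have o: "outer_prod u u \<in> carrier_mat n n" "outer_prod y u \<in> carrier_mat m n"
      using u y by (auto intro!: carrier_matI)
    have "Q + outer_prod u u = M * (Y + outer_prod y u)"
      using M Y y o mult_outer_prod[of M y u] by (simp add: mult_add_distrib_mat[OF M Y] QY uy)
    moreover have "(Q + outer_prod u u) *\<^sub>v col M j = col M j" if "j < Suc l" for j
    proof (cases "j = l")
      case False
      then have j: "j < l" using that by simp
      have cj: "col M j \<in> carrier_vec n" using M j l by (intro col_carrier_vec) auto
      have "u \<bullet> col M j = u \<bullet> (Q *\<^sub>v col M j)" using fixed[OF j] by simp
      also have "\<dots> = (Q *\<^sub>v u) \<bullet> col M j"
        using transpose_vec_mult_scalar[OF Q(1) cj u] Q(2) by (simp add: is_orth_proj_def)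
      also have "\<dots> = 0" using Qu cj by simp
      finally show ?thesis
        using M cj u fixed[OF j]
        by (simp add: add_mult_distrib_mat_vec[OF Q(1) o(1) cj] outer_prod_mult_vec)
          (intro eq_vecI, auto)
    qed (use uc c_def in simp)
    moreover have "Q + outer_prod u u \<in> carrier_mat n n" "Y + outer_prod y u \<in> carrier_mat m n"
      using Q Y o by simp_all
    moreover have "frob_sq (Q + outer_prod u u) \<le> real (Suc l)" using sq sq' by simp
    ultimately show ?case using proj by blast
  qed
  from this[of m] obtain Q Y where Q: "Q \<in> carrier_mat n n" "Y \<in> carrier_mat m n" "is_orth_proj Q"
    "Q = M * Y" "\<And>j. j < m \<Longrightarrow> Q *\<^sub>v col M j = col M j" "frob_sq Q \<le> real m" by auto
  moreover have "Q * M = M"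
    using Q(1,5) M col_mult2[OF Q(1) M] by (intro mat_col_eqI) (auto simp del: assoc_mult_mat)
  ultimately show ?thesis by (intro that[of Q Y])
qed

section \<open>The Moore--Penrose pseudoinverse\<close>

lemma is_pinv_unique:
  assumes X: "is_pinv M X" and Z: "is_pinv M Z"
  shows "X = Z"
proof -
  have d [simp]: "dim_row X = dim_col M" "dim_col X = dim_row M"
    "dim_row Z = dim_col M" "dim_col Z = dim_row M"
    using X Z by (auto simp: is_pinv_def)
  note x = X[unfolded is_pinv_def] and z = Z[unfolded is_pinv_def]
  have "M * X = (M * Z) * (M * X)"
    using z by (simp add: mult_assoc_dim[symmetric])
  also have "\<dots> = (M * Z)\<^sup>T * (M * X)\<^sup>T" using x z by simp
  also have "\<dots> = ((M * X) * (M * Z))\<^sup>T" by (rule transpose_mult_dim[symmetric]) simp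
  also have "(M * X) * (M * Z) = M * Z"
    using x by (simp add: mult_assoc_dim[symmetric])
  finally have MX: "M * X = M * Z" using z by simp
  have "X * M = (X * M) * (Z * M)"
    using z by (simp add: mult_assoc_dim)
  also have "\<dots> = (X * M)\<^sup>T * (Z * M)\<^sup>T" using x z by simp
  also have "\<dots> = ((Z * M) * (X * M))\<^sup>T" by (rule transpose_mult_dim[symmetric]) simp
  also have "(Z * M) * (X * M) = Z * M"
    using x by (simp add: mult_assoc_dim)
  finally have XM: "X * M = Z * M" using z by simp
  have "X = X * M * X" using x by simp
  also have "\<dots> = Z * M * X" by (simp add: XM)
  also have "\<dots> = Z * M * Z" by (simp add: MX mult_assoc_dim)
  finally show ?thesis using z by simp
qed

text \<open>With \<open>Q = M Y\<close> the projection onto the column space and \<open>Q' = M\<^sup>T Y'\<close> the projection onto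
the row space, \<open>Q' Y\<close> is the pseudoinverse: it satisfies \<open>M (Q' Y) = Q\<close> and \<open>(Q' Y) M = Q'\<close>.\<close>

lemma is_pinv_exists: "\<exists>X. is_pinv M X"
proof -
  have M: "M \<in> carrier_mat (dim_row M) (dim_col M)" by simp
  obtain Q Y where Q: "Q \<in> carrier_mat (dim_row M) (dim_row M)"
    and Y: "Y \<in> carrier_mat (dim_col M) (dim_row M)"
    and p: "is_orth_proj Q" "Q = M * Y" "Q * M = M"
    using orth_proj_column_space[OF M] by metis
  have MT: "M\<^sup>T \<in> carrier_mat (dim_col M) (dim_row M)" by simp
  obtain Q' Y' where Q': "Q' \<in> carrier_mat (dim_col M) (dim_col M)"
    and Y': "Y' \<in> carrier_mat (dim_row M) (dim_col M)"
    and p': "is_orth_proj Q'" "Q' = M\<^sup>T * Y'" "Q' * M\<^sup>T = M\<^sup>T"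
    using orth_proj_column_space[OF MT] by metis
  have [simp]: "dim_row Q = dim_row M" "dim_col Q = dim_row M" "dim_row Q' = dim_col M"
    "dim_col Q' = dim_col M" "dim_row Y = dim_col M" "dim_col Y = dim_row M"
    "dim_row Y' = dim_row M" "dim_col Y' = dim_col M"
    using Q Y Q' Y' by auto
  have MQ': "M * Q' = M"
    using arg_cong[OF p'(3), of transpose_mat] p'(1)
    by (simp add: transpose_mult_dim is_orth_proj_def)
  have "Q' = Q'\<^sup>T" using p' by (simp add: is_orth_proj_def)
  also have "\<dots> = Y'\<^sup>T * M" unfolding p'(2) by (simp add: transpose_mult_dim)
  finally have Q'M: "Q' = Y'\<^sup>T * M" .
  have MX: "M * (Q' * Y) = Q"
    using MQ' p(2) by (simp add: mult_assoc_dim[symmetric])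
  have "Q' * Y * M = Y'\<^sup>T * (Q * M)"
    unfolding Q'M p(2) by (simp add: mult_assoc_dim)
  then have XM: "Q' * Y * M = Q'" using p(3) Q'M by simp
  have "Q' * (Q' * Y) = Q' * Y"
    using p'(1) by (simp add: mult_assoc_dim[symmetric] is_orth_proj_def)
  moreover have "Q' * Y \<in> carrier_mat (dim_col M) (dim_row M)" using Q' Y by (rule mult_carrier_mat)
  moreover have "Q\<^sup>T = Q" "Q'\<^sup>T = Q'" using p(1) p'(1) unfolding is_orth_proj_def by blast+
  ultimately have "is_pinv M (Q' * Y)"
    unfolding is_pinv_def MX XM using p(3) by (intro conjI)
  then show ?thesis ..
qed

lemma is_pinv_pinv: "is_pinv M (pinv M)"
  unfolding pinv_def using is_pinv_exists is_pinv_unique by (metis theI)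

lemma pinv_dim [simp]: "dim_row (pinv M) = dim_col M" "dim_col (pinv M) = dim_row M"
  using is_pinv_pinv[of M] by (auto simp: is_pinv_def)

lemma orth_proj_mult_pinv: "is_orth_proj (M * pinv M)" and mult_pinv_mult: "M * pinv M * M = M"
proof -
  note p = is_pinv_pinv[of M, unfolded is_pinv_def]
  show "M * pinv M * M = M" using p by simp
  have "M * pinv M * (M * pinv M) = (M * pinv M * M) * pinv M"
    by (simp add: mult_assoc_dim)
  then show "is_orth_proj (M * pinv M)"
    unfolding is_orth_proj_def using p by (simp only: simp_thms)
qed

section \<open>Rank factorization\<close>

lemma rank_mult_le_dim_col:
  fixes B E :: "real mat"
  assumes B: "B \<in> carrier_mat n k" and E: "E \<in> carrier_mat k d"
  shows "vec_space.rank n (B * E) \<le> k"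
proof -
  interpret vec_space "TYPE(real)" n .
  have BE: "B * E \<in> carrier_mat n d" using B E by simp
  have cB: "set (cols B) \<subseteq> carrier_vec n" and cBE: "set (cols (B * E)) \<subseteq> carrier_vec n"
    using B BE cols_dim by (metis carrier_matD(1))+
  have "set (cols (B * E)) \<subseteq> span (set (cols B))"
  proof
    fix x assume "x \<in> set (cols (B * E))"
    then obtain j where "j < d" "x = col (B * E) j"
      using BE by (auto simp: cols_def)
    then have "x = B *\<^sub>v col E j" "col E j \<in> carrier_vec k" using B E by auto
    then show "x \<in> span (set (cols B))"
      using col_space_eq[OF B] B unfolding col_space_def by auto
  qed
  then have "span (set (cols (B * E))) \<subseteq> span (set (cols B))"
    using cB by (meson span_is_submodule span_is_subset)
  then have "subspace class_ring (span (set (cols (B * E)))) (span_vs (set (cols B)))"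
    using nested_subspaces span_is_subspace cB cBE by blast
  then have "rank (B * E) \<le> rank B"
    unfolding rank_def
    using vectorspace.subspace_dim[OF subspace_is_vs[OF span_is_subspace[OF cB]]]
      fin_dim_span_cols[OF B] fin_dim_span_cols[OF BE] by auto
  then show ?thesis using rank_le_nc[OF B] by simp
qed

text \<open>A maximal independent set of columns of \<open>X\<close> has \<open>rank X\<close> elements and spans all columns; \<open>E\<close>
collects the coefficients.\<close>

lemma rank_factorization:
  fixes X :: "real mat"
  assumes X: "X \<in> carrier_mat n d"
  obtains B E where "B \<in> carrier_mat n (vec_space.rank n X)" "E \<in> carrier_mat (vec_space.rank n X) d"
    "X = B * E"
proof -
  interpret vec_space "TYPE(real)" n .
  have cX: "set (cols X) \<subseteq> carrier_vec n" using X cols_dim by (metis carrier_matD(1))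
  obtain S where S: "maximal S (\<lambda>T. T \<subseteq> set (cols X) \<and> lin_indpt T)" "finite S"
    using maximal_exists_superset[of "set (cols X)" "\<lambda>T. T \<subseteq> set (cols X) \<and> lin_indpt T" "{}"]
    by (auto simp: lin_dep_def)
  have SX: "S \<subseteq> set (cols X)" and li: "lin_indpt S" using S(1) by (auto simp: maximal_def)
  have Sc: "S \<subseteq> carrier_vec n" using SX cX by blast
  obtain bs where bs: "set bs = S" "distinct bs" using finite_distinct_list[OF S(2)] by blast
  have card: "length bs = rank X"
    using rank_card_indpt[OF X S(1)] bs distinct_card by fastforce
  define B where "B = mat_of_cols n bs"
  have B: "B \<in> carrier_mat n (rank X)" using card by (intro carrier_matI) (simp_all add: B_def)
  have cols_B: "cols B = bs" using bs Sc by (simp add: B_def)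
  have span: "x \<in> span S" if "x \<in> set (cols X)" for x
  proof (rule ccontr)
    assume x: "x \<notin> span S"
    then have "lin_indpt (S \<union> {x})"
      using lin_dep_iff_in_span[OF Sc li, of x] that cX span_mem[OF Sc] by blast
    then have "S \<union> {x} = S"
      using S(1) that SX by (auto simp: maximal_def)
    then show False using x span_mem[OF Sc] by blast
  qed
  have "\<exists>w. w \<in> carrier_vec (rank X) \<and> col X j = B *\<^sub>v w" if "j < d" for j
  proof -
    have "col X j \<in> set (cols X)" using that X by (auto simp: cols_def)
    then have "col X j \<in> col_space B" using span by (simp add: col_space_def cols_B bs)
    then show ?thesis using col_space_eq[OF B] B by auto
  qed
  then obtain w where w: "\<And>j. j < d \<Longrightarrow> w j \<in> carrier_vec (rank X) \<and> col X j = B *\<^sub>v w j"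
    by metis
  define E where "E = mat (rank X) d (\<lambda>(i, j). w j $ i)"
  have E: "E \<in> carrier_mat (rank X) d" by (simp add: E_def)
  have "col E j = w j" if "j < d" for j
    using w[OF that] that by (intro eq_vecI) (auto simp: E_def)
  then have "X = B * E"
    using X B E w by (intro mat_col_eqI) auto
  then show ?thesis using that B E by blast
qed

section \<open>Truncated singular value decompositions and the Eckart--Young theorem\<close>

lemma rect_diag_dim [simp]: "dim_row (rect_diag a b s) = a" "dim_col (rect_diag a b s) = b"
  by (simp_all add: rect_diag_def)

lemma rect_diag_transpose: "(rect_diag a b s)\<^sup>T = rect_diag b a s"
  by (intro eq_matI) (auto simp: rect_diag_def)

lemma rect_diag_mult:
  "rect_diag a b s * rect_diag b c t = rect_diag a c (\<lambda>i. if i < b then s i * t i else 0)"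
proof (intro eq_matI)
  fix i j assume ij: "i < dim_row (rect_diag a c (\<lambda>i. if i < b then s i * t i else 0))"
    "j < dim_col (rect_diag a c (\<lambda>i. if i < b then s i * t i else 0))"
  have "(rect_diag a b s * rect_diag b c t) $$ (i, j) =
      (\<Sum>l<b. rect_diag a b s $$ (i, l) * rect_diag b c t $$ (l, j))"
    using ij by (simp add: scalar_prod_def atLeast0LessThan)
  also have "\<dots> = (\<Sum>l<b. if l = i then s i * (if i = j then t i else 0) else 0)"
    using ij by (intro sum.cong) (auto simp: rect_diag_def)
  also have "\<dots> = rect_diag a c (\<lambda>i. if i < b then s i * t i else 0) $$ (i, j)"
    using ij by (simp add: rect_diag_def)
  finally show "(rect_diag a b s * rect_diag b c t) $$ (i, j) =
    rect_diag a c (\<lambda>i. if i < b then s i * t i else 0) $$ (i, j)" .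
qed simp_all

lemma frob_sq_rect_diag: "frob_sq (rect_diag n d s) = (\<Sum>i<min n d. (s i)\<^sup>2)"
proof -
  have "frob_sq (rect_diag n d s) = (\<Sum>i<n. \<Sum>j<d. if j = i then (s i)\<^sup>2 else 0)"
    unfolding frob_ip_def rect_diag_dim
    by (intro sum.cong refl) (simp add: rect_diag_def power2_eq_square)
  also have "\<dots> = (\<Sum>i<n. if i < d then (s i)\<^sup>2 else 0)" by simp
  also have "\<dots> = (\<Sum>i<min n d. (s i)\<^sup>2)"
    by (rule sum.mono_neutral_cong_right) auto
  finally show ?thesis .
qed

text \<open>Truncation is right multiplication by the projection \<open>H H\<^sup>T\<close> onto the first \<open>k\<close> right
singular vectors, the columns of \<open>H\<close>. It shows at once that
the rank is at most \<open>k\<close> and that left multiplication keeps this form.\<close>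

lemma svd_trunc_right_projection:
  assumes "is_svd_trunc k M Mk" and k: "k \<le> dim_col M"
  obtains H where "H \<in> carrier_mat (dim_col M) k" "H\<^sup>T * H = 1\<^sub>m k" "Mk = M * H * H\<^sup>T"
proof -
  define n d where "n = dim_row M" and "d = dim_col M"
  obtain U \<sigma> V where svd: "is_svd M U \<sigma> V"
    and Mk: "Mk = U * rect_diag n d (\<lambda>i. if i < k then \<sigma> i else 0) * V\<^sup>T"
    using assms by (auto simp: is_svd_trunc_def n_def d_def)
  have [simp]: "dim_row U = n" "dim_col U = n" "dim_row V = d" "dim_col V = d"
    and V: "V\<^sup>T * V = 1\<^sub>m d" and M: "M = U * rect_diag n d \<sigma> * V\<^sup>T"
    using svd by (auto simp: is_svd_def is_orthogonal_mat_def n_def d_def)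
  define J where "J = rect_diag d k (\<lambda>_. 1)"
  have [simp]: "dim_row J = d" "dim_col J = k" by (simp_all add: J_def)
  have JJ: "J\<^sup>T * J = 1\<^sub>m k"
    using k by (auto simp: J_def rect_diag_transpose rect_diag_mult d_def)
      (auto simp: rect_diag_def)
  have DJ: "rect_diag n d \<sigma> * J * J\<^sup>T = rect_diag n d (\<lambda>i. if i < k then \<sigma> i else 0)"
    using k by (auto simp: J_def rect_diag_transpose rect_diag_mult d_def)
      (auto simp: rect_diag_def)
  have VX: "V\<^sup>T * (V * Z) = Z" if "dim_row Z = d" for Z
    using that V by (simp add: mult_assoc_dim[symmetric])
  have "(V * J)\<^sup>T * (V * J) = 1\<^sub>m k"
    by (simp add: transpose_mult_dim mult_assoc_dim VX JJ)
  moreover have "Mk = M * (V * J) * (V * J)\<^sup>T"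
  proof -
    have "M * (V * J) * (V * J)\<^sup>T = U * (rect_diag n d \<sigma> * J * J\<^sup>T) * V\<^sup>T"
      unfolding M by (simp add: transpose_mult_dim mult_assoc_dim VX)
    then show ?thesis by (simp add: DJ Mk)
  qed
  ultimately show ?thesis by (intro that[of "V * J"]) (auto simp: d_def[symmetric] intro!: carrier_matI)
qed

text \<open>Weights between 0 and 1 of total mass at most \<open>k\<close> do best by sitting on the \<open>k\<close> largest terms.
Subtracting \<open>c = s k\<close> makes this visible term by term: \<open>s i - c\<close> is nonnegative for \<open>i < k\<close>
and nonpositive from \<open>k\<close> on.\<close>

lemma sum_decreasing_weights_le:
  fixes s w :: "nat \<Rightarrow> real"
  assumes s0: "\<And>i. i < m \<Longrightarrow> 0 \<le> s i" and dec: "\<And>i j. i \<le> j \<Longrightarrow> j < m \<Longrightarrow> s j \<le> s i"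
    and w: "\<And>i. i < m \<Longrightarrow> 0 \<le> w i \<and> w i \<le> 1" and sw: "(\<Sum>i<m. w i) \<le> real k"
  shows "(\<Sum>i<m. s i * w i) \<le> (\<Sum>i<m. if i < k then s i else 0)"
proof (cases "k < m")
  case False
  then show ?thesis using s0 w by (intro sum_mono) (auto simp: mult_left_le)
next
  case True
  define c where "c = s k"
  have c: "0 \<le> c" using s0 True by (simp add: c_def)
  have le: "(s i - c) * w i \<le> (if i < k then s i - c else 0)" if "i < m" for i
  proof (cases "i < k")
    case T: True
    then show ?thesis using w[OF that] dec[of i k] True
      by (simp add: c_def mult_left_le)
  next
    case False
    then show ?thesis using w[OF that] dec[of k i] that
      by (simp add: c_def mult_nonpos_nonneg)
  qed
  have "(\<Sum>i<m. s i * w i) = (\<Sum>i<m. (s i - c) * w i) + c * (\<Sum>i<m. w i)"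
    by (simp add: algebra_simps sum.distrib[symmetric] sum_distrib_left)
  also have "\<dots> \<le> (\<Sum>i<m. if i < k then s i - c else 0) + c * real k"
    using le sw c by (intro add_mono sum_mono mult_left_mono) auto
  also have "c * real k = (\<Sum>i<m. if i < k then c else 0)"
  proof -
    have "(\<Sum>i<m. if i < k then c else 0) = (\<Sum>i<k. c)"
      using True by (intro sum.mono_neutral_cong_right) auto
    then show ?thesis by simp
  qed
  also have "(\<Sum>i<m. if i < k then s i - c else 0) + \<dots> = (\<Sum>i<m. if i < k then s i else 0)"
    by (simp add: sum.distrib[symmetric] if_distrib cong: if_cong)
  finally show ?thesis .
qed

lemma orth_proj_Pythagoras:
  assumes "is_orth_proj Q" "dim_row Q = dim_row X" "dim_row Z = dim_row X" "dim_col Z = dim_col X"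
    and QZ: "Q * Z = Z"
  shows "frob_sq (X - Z) = frob_sq (X - Q * X) + frob_sq (Q * X - Z)"
proof -
  have [simp]: "dim_col Q = dim_row X" using orth_proj_square assms by metis
  have QT: "Q\<^sup>T = Q" and QQ: "Q * Q = Q" using assms by (auto simp: is_orth_proj_def)
  have c: "X \<in> carrier_mat (dim_row X) (dim_col X)" "Z \<in> carrier_mat (dim_row X) (dim_col X)"
    "Q \<in> carrier_mat (dim_row X) (dim_row X)" "Q * X \<in> carrier_mat (dim_row X) (dim_col X)"
    using assms by (auto intro!: carrier_matI)
  have Q0: "Q * (X - Q * X) = 0\<^sub>m (dim_row X) (dim_col X)"
  proof -
    have "Q * (X - Q * X) = Q * X - Q * (Q * X)"
      by (rule mult_minus_distrib_mat[OF c(3,1,4)])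
    also have "Q * (Q * X) = Q * X"
      using mult_assoc_dim[of Q Q X] assms(2) by (simp add: QQ)
    finally show ?thesis by (simp add: minus_r_inv_mat[OF c(4)])
  qed
  have QD: "Q * X - Z = Q * (X - Z)"
    using mult_minus_distrib_mat[OF c(3,1,2)] QZ by simp
  have "frob_ip (X - Q * X) (Q * X - Z) = frob_ip (Q * X - Z) (X - Q * X)"
    using assms(2-4) by (intro frob_ip_commute) auto
  also have "\<dots> = frob_ip (X - Z) (Q * (X - Q * X))"
    unfolding QD using assms(2-4) by (simp add: frob_ip_mult_left QT)
  also have "\<dots> = 0" unfolding Q0 using assms(2-4) by (simp add: frob_ip_def)
  finally have 0: "frob_ip (X - Q * X) (Q * X - Z) = 0" .
  have "X - Z = (X - Q * X) + (Q * X - Z)"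
    using assms(2-4) by (intro eq_matI) auto
  then show ?thesis using frob_sq_add[OF _ _ 0] assms(2-4) by simp
qed

lemma orth_proj_frob_sq:
  assumes "is_orth_proj Q" "dim_row Q = dim_row X"
  shows "frob_sq X = frob_sq (X - Q * X) + frob_sq (Q * X)"
proof -
  have [simp]: "dim_col Q = dim_row X" using orth_proj_square assms by metis
  have z: "Q * 0\<^sub>m (dim_row X) (dim_col X) = 0\<^sub>m (dim_row X) (dim_col X)"
    using assms by (intro right_mult_zero_mat) (auto intro!: carrier_matI)
  have m: "Z - 0\<^sub>m (dim_row X) (dim_col X) = Z" if "dim_row Z = dim_row X" "dim_col Z = dim_col X"
    for Z :: "real mat"
    using that by (intro eq_matI) auto
  show ?thesis using orth_proj_Pythagoras[OF assms, of "0\<^sub>m (dim_row X) (dim_col X)"] z assms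
    by (simp add: m)
qed

text \<open>In the basis of left singular vectors, the squared norm of \<open>Q M\<close> is the sum of the \<open>(\<sigma> j)\<^sup>2\<close> with
weights the squared lengths of the vectors \<open>Q u\<close>, for \<open>u\<close> the \<open>j\<close>-th left singular vector. These
lengths are at most 1, and over an orthonormal basis their squares sum to the squared norm of
\<open>Q\<close>, hence to at most \<open>k\<close>.\<close>

lemma frob_sq_orth_proj_svd_le:
  assumes svd: "is_svd M U \<sigma> V"
    and Q: "Q \<in> carrier_mat (dim_row M) (dim_row M)" "is_orth_proj Q" "frob_sq Q \<le> real k"
  shows "frob_sq (Q * M) \<le> (\<Sum>i<min (dim_row M) (dim_col M). if i < k then (\<sigma> i)\<^sup>2 else 0)"
proof -
  define n d where "n = dim_row M" and "d = dim_col M"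
  define m where "m = min n d"
  have [simp]: "dim_row U = n" "dim_col U = n" "dim_row V = d" "dim_col V = d"
    "dim_row Q = n" "dim_col Q = n"
    and V: "V\<^sup>T * V = 1\<^sub>m d" and U: "U\<^sup>T * U = 1\<^sub>m n" "U * U\<^sup>T = 1\<^sub>m n"
    and M: "M = U * rect_diag n d \<sigma> * V\<^sup>T"
    and pos: "\<And>i. i < m \<Longrightarrow> 0 \<le> \<sigma> i" and dec: "\<And>i j. i \<le> j \<Longrightarrow> j < m \<Longrightarrow> \<sigma> j \<le> \<sigma> i"
    using svd Q by (auto simp: is_svd_def is_orthogonal_mat_def n_def d_def m_def)
  have QT: "Q\<^sup>T = Q" and QQ: "Q * Q = Q" using Q by (auto simp: is_orth_proj_def)
  define W where "W = Q * U"
  define w where "w j = col W j \<bullet> col W j" for j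
  have [simp]: "dim_row W = n" "dim_col W = n" by (simp_all add: W_def)
  have "frob_sq (Q * M) = frob_sq (W * rect_diag n d \<sigma> * V\<^sup>T)"
    by (simp add: M W_def mult_assoc_dim)
  also have "\<dots> = frob_sq (W * rect_diag n d \<sigma>)"
    using V by (intro frob_sq_isometry_right) auto
  also have "\<dots> = (\<Sum>j<d. if j < n then (\<sigma> j)\<^sup>2 * w j else 0)"
    unfolding frob_sq_cols
  proof (rule sum.cong)
    fix j assume j: "j \<in> {..<d}"
    have "col (W * rect_diag n d \<sigma>) j = (if j < n then \<sigma> j \<cdot>\<^sub>v col W j else 0\<^sub>v n)"
    proof (intro eq_vecI)
      fix i assume "i < dim_vec (if j < n then \<sigma> j \<cdot>\<^sub>v col W j else 0\<^sub>v n)"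
      then have i: "i < n" by (simp split: if_splits)
      have "col (W * rect_diag n d \<sigma>) j $ i = (\<Sum>l<n. W $$ (i, l) * rect_diag n d \<sigma> $$ (l, j))"
        using i j by (simp add: scalar_prod_def atLeast0LessThan)
      also have "\<dots> = (\<Sum>l<n. if l = j then W $$ (i, j) * \<sigma> j else 0)"
        using i j by (intro sum.cong) (auto simp: rect_diag_def)
      finally show "col (W * rect_diag n d \<sigma>) j $ i = (if j < n then \<sigma> j \<cdot>\<^sub>v col W j else 0\<^sub>v n) $ i"
        using i j by simp
    qed simp
    then show "col (W * rect_diag n d \<sigma>) j \<bullet> col (W * rect_diag n d \<sigma>) j =
        (if j < n then (\<sigma> j)\<^sup>2 * w j else 0)"
      by (simp add: w_def power2_eq_square)
  qed simp
  also have "\<dots> = (\<Sum>j<m. (\<sigma> j)\<^sup>2 * w j)"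
    by (rule sum.mono_neutral_cong_right) (auto simp: m_def)
  also have "\<dots> \<le> (\<Sum>i<m. if i < k then (\<sigma> i)\<^sup>2 else 0)"
  proof (rule sum_decreasing_weights_le)
    fix i j :: nat assume "i \<le> j" "j < m"
    then show "(\<sigma> j)\<^sup>2 \<le> (\<sigma> i)\<^sup>2" using dec pos by (intro power_mono) auto
  next
    fix j assume j: "j < m"
    then have jn: "j < n" by (simp add: m_def)
    let ?u = "mat n 1 (\<lambda>(i, _). U $$ (i, j))"
    have "col U j \<bullet> col U j = (U\<^sup>T * U) $$ (j, j)" using jn by simp
    also have "\<dots> = 1" using U jn by simp
    finally have "frob_sq ?u = 1" using jn by (simp add: frob_ip_def scalar_prod_def atLeast0LessThan)
    moreover have "col W j = col (Q * ?u) 0"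
      using jn by (intro eq_vecI) (auto simp: W_def scalar_prod_def)
    then have "frob_sq (Q * ?u) = w j" by (simp add: frob_sq_cols w_def)
    ultimately show "0 \<le> w j \<and> w j \<le> 1"
      using orth_proj_frob_sq[OF Q(2), of ?u] frob_sq_nonneg[of "Q * ?u"]
        frob_sq_nonneg[of "?u - Q * ?u"] by simp
  next
    have "(\<Sum>j<m. w j) \<le> (\<Sum>j<n. w j)"
      by (intro sum_mono2) (auto simp: m_def w_def scalar_prod_self_nonneg)
    also have "\<dots> = frob_sq (Q * (U\<^sup>T)\<^sup>T)" by (simp add: frob_sq_cols w_def W_def)
    also have "\<dots> = frob_sq Q"
      using U by (intro frob_sq_isometry_right) auto
    finally show "(\<Sum>j<m. w j) \<le> real k" using Q by simp
  qed simp
  finally show ?thesis by (simp add: m_def n_def d_def)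
qed

text \<open>If \<open>Q\<close> projects onto the column space of \<open>X\<close>, then by Pythagoras \<open>Q M\<close> approximates \<open>M\<close> at least
as well as \<open>X\<close> does, and the error of \<open>Q M\<close> is smallest when \<open>Q M\<close> has the largest norm.\<close>

lemma Eckart_Young_frob:
  assumes trunc: "is_svd_trunc k M Mk"
    and X: "X \<in> carrier_mat (dim_row M) (dim_col M)" "vec_space.rank (dim_row M) X \<le> k"
  shows "frob_sq (M - Mk) \<le> frob_sq (M - X)"
proof -
  define n d where "n = dim_row M" and "d = dim_col M"
  define m where "m = min n d"
  obtain U \<sigma> V where svd: "is_svd M U \<sigma> V"
    and Mk: "Mk = U * rect_diag n d (\<lambda>i. if i < k then \<sigma> i else 0) * V\<^sup>T"
    using trunc by (auto simp: is_svd_trunc_def n_def d_def)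
  have [simp]: "dim_row U = n" "dim_col U = n" "dim_row V = d" "dim_col V = d"
    and UV: "U\<^sup>T * U = 1\<^sub>m n" "V\<^sup>T * V = 1\<^sub>m d" and M: "M = U * rect_diag n d \<sigma> * V\<^sup>T"
    using svd by (auto simp: is_svd_def is_orthogonal_mat_def n_def d_def)
  have diag: "frob_sq (U * rect_diag n d s * V\<^sup>T) = (\<Sum>i<m. (s i)\<^sup>2)" for s
    using UV by (simp add: frob_sq_isometry_left frob_sq_isometry_right frob_sq_rect_diag m_def)
  have "M - Mk = U * rect_diag n d (\<lambda>i. if i < k then 0 else \<sigma> i) * V\<^sup>T"
  proof -
    have c: "U * rect_diag n d s \<in> carrier_mat n d" "V\<^sup>T \<in> carrier_mat d d"
      "U \<in> carrier_mat n n" "rect_diag n d s \<in> carrier_mat n d" for s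
      by (auto intro!: carrier_matI)
    have "U * (rect_diag n d \<sigma> - rect_diag n d (\<lambda>i. if i < k then \<sigma> i else 0)) * V\<^sup>T = M - Mk"
      unfolding M Mk mult_minus_distrib_mat[OF c(3,4,4)]
      by (rule minus_mult_distrib_mat[OF c(1,1,2)])
    then have "M - Mk = U * (rect_diag n d \<sigma> - rect_diag n d (\<lambda>i. if i < k then \<sigma> i else 0)) * V\<^sup>T" ..
    also have "rect_diag n d \<sigma> - rect_diag n d (\<lambda>i. if i < k then \<sigma> i else 0) =
        rect_diag n d (\<lambda>i. if i < k then 0 else \<sigma> i)"
      by (intro eq_matI) (auto simp: rect_diag_def)
    finally show ?thesis .
  qed
  then have "frob_sq (M - Mk) = (\<Sum>i<m. (if i < k then 0 else \<sigma> i)\<^sup>2)" by (simp only: diag)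
  also have "\<dots> = (\<Sum>i<m. (\<sigma> i)\<^sup>2) - (\<Sum>i<m. if i < k then (\<sigma> i)\<^sup>2 else 0)"
    by (subst sum_subtractf[symmetric]) (auto intro!: sum.cong)
  also have "(\<Sum>i<m. (\<sigma> i)\<^sup>2) = frob_sq M" unfolding M by (simp only: diag)
  finally have Mk': "frob_sq (M - Mk) = frob_sq M - (\<Sum>i<m. if i < k then (\<sigma> i)\<^sup>2 else 0)" .
  obtain B E where B: "B \<in> carrier_mat n (vec_space.rank n X)"
    and E: "E \<in> carrier_mat (vec_space.rank n X) d" and XBE: "X = B * E"
    using rank_factorization[of X n d] X by (auto simp: n_def d_def)
  obtain Q where Q: "Q \<in> carrier_mat n n" "is_orth_proj Q" "Q * B = B"
    "frob_sq Q \<le> real (vec_space.rank n X)"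
    using orth_proj_column_space[OF B] by metis
  have QX: "Q * X = X" unfolding XBE using assoc_mult_mat[OF Q(1) B E] Q(3) by simp
  have "frob_sq (Q * M) \<le> (\<Sum>i<m. if i < k then (\<sigma> i)\<^sup>2 else 0)"
    unfolding m_def n_def d_def
    using Q X by (intro frob_sq_orth_proj_svd_le[OF svd]) (auto simp: n_def)
  moreover have "frob_sq (M - X) = frob_sq (M - Q * M) + frob_sq (Q * M - X)"
    using Q X QX by (intro orth_proj_Pythagoras) (auto simp: n_def)
  moreover have "frob_sq M = frob_sq (M - Q * M) + frob_sq (Q * M)"
    using Q by (intro orth_proj_frob_sq) (auto simp: n_def)
  ultimately show ?thesis using Mk' frob_sq_nonneg[of "Q * M - X"] by linarith
qed

section \<open>Ridge leverage scores\<close>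

lemma ridge_quadratic_form:
  fixes A :: "real mat"
  assumes A: "A \<in> carrier_mat n d" and x: "x \<in> carrier_vec n" and y: "y \<in> carrier_vec n"
  shows "x \<bullet> ((A * A\<^sup>T + l \<cdot>\<^sub>m 1\<^sub>m n) *\<^sub>v y) = (A\<^sup>T *\<^sub>v x) \<bullet> (A\<^sup>T *\<^sub>v y) + l * (x \<bullet> y)"
proof -
  have Aty: "A\<^sup>T *\<^sub>v y \<in> carrier_vec d" using A y by simp
  have "(l \<cdot>\<^sub>m 1\<^sub>m n) *\<^sub>v y = l \<cdot>\<^sub>v y"
    using y by (intro eq_vecI) (auto simp: row_smult)
  moreover have "(A * A\<^sup>T) *\<^sub>v y = A *\<^sub>v (A\<^sup>T *\<^sub>v y)"
    using A y by (intro assoc_mult_mat_vec) auto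
  moreover have "(A * A\<^sup>T + l \<cdot>\<^sub>m 1\<^sub>m n) *\<^sub>v y = (A * A\<^sup>T) *\<^sub>v y + (l \<cdot>\<^sub>m 1\<^sub>m n) *\<^sub>v y"
    using A y by (intro add_mult_distrib_mat_vec) auto
  ultimately have "(A * A\<^sup>T + l \<cdot>\<^sub>m 1\<^sub>m n) *\<^sub>v y = A *\<^sub>v (A\<^sup>T *\<^sub>v y) + l \<cdot>\<^sub>v y" by simp
  moreover have "x \<bullet> (A *\<^sub>v (A\<^sup>T *\<^sub>v y) + l \<cdot>\<^sub>v y) = x \<bullet> (A *\<^sub>v (A\<^sup>T *\<^sub>v y)) + x \<bullet> (l \<cdot>\<^sub>v y)"
    using x y A Aty by (intro scalar_prod_add_distrib) auto
  ultimately show ?thesis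
    using transpose_vec_mult_scalar[OF A Aty x] x y by simp
qed

lemma ridge_matrix_symmetric:
  fixes A :: "real mat"
  assumes A: "A \<in> carrier_mat n d"
  shows "(A * A\<^sup>T + l \<cdot>\<^sub>m 1\<^sub>m n)\<^sup>T = A * A\<^sup>T + l \<cdot>\<^sub>m 1\<^sub>m n"
proof -
  have "(A * A\<^sup>T + l \<cdot>\<^sub>m 1\<^sub>m n)\<^sup>T = (A * A\<^sup>T)\<^sup>T + (l \<cdot>\<^sub>m 1\<^sub>m n)\<^sup>T"
    using A by (intro transpose_add) auto
  also have "(A * A\<^sup>T)\<^sup>T = A * A\<^sup>T" by (simp add: transpose_mult_dim)
  also have "(l \<cdot>\<^sub>m 1\<^sub>m n)\<^sup>T = l \<cdot>\<^sub>m 1\<^sub>m n" by (intro eq_matI) auto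
  finally show ?thesis .
qed

text \<open>If \<open>l = 0\<close>, then \<open>K\<close> may be singular, so that \<open>K (pinv K)\<close> is only the projection onto the range
of \<open>K\<close>. The columns of \<open>A\<close> lie in that range: the component \<open>z\<close> of a column orthogonal to it satisfies
\<open>K z = 0\<close>, so \<open>A\<^sup>T z = 0\<close> by the quadratic form, and thus \<open>z\<close> is orthogonal to the very
column from which it was split off and has to vanish.\<close>

lemma ridge_pinv_fixes_columns:
  fixes A :: "real mat"
  assumes A: "A \<in> carrier_mat n d" and l: "0 \<le> l" and i: "i < d"
  defines "K \<equiv> A * A\<^sup>T + l \<cdot>\<^sub>m 1\<^sub>m n"
  shows "K *\<^sub>v (pinv K *\<^sub>v col A i) = col A i"
proof -
  define Q where "Q = K * pinv K"
  have K: "K \<in> carrier_mat n n" using A by (simp add: K_def)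
  have [simp]: "dim_row K = n" "dim_col K = n" using K by auto
  have pK: "pinv K \<in> carrier_mat n n" by (intro carrier_matI) simp_all
  have Q: "Q \<in> carrier_mat n n" using K pK by (simp add: Q_def)
  have QT: "Q\<^sup>T = Q" and QQ: "Q * Q = Q" and QK: "Q * K = K"
    using orth_proj_mult_pinv[of K] mult_pinv_mult[of K] unfolding Q_def is_orth_proj_def by blast+
  have KT: "K\<^sup>T = K" unfolding K_def by (rule ridge_matrix_symmetric[OF A])
  have KQ: "K * Q = K"
    using arg_cong[OF QK, of transpose_mat] transpose_mult[OF Q K] by (simp only: KT QT)
  define a where "a = col A i"
  have a: "a \<in> carrier_vec n" using A i by (simp add: a_def)
  have Qa: "Q *\<^sub>v a \<in> carrier_vec n" using Q a by simp
  define z where "z = a - Q *\<^sub>v a"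
  have z: "z \<in> carrier_vec n" using a Qa by (simp add: z_def)
  have Atz: "A\<^sup>T *\<^sub>v z \<in> carrier_vec d" using A z by simp
  have "Q *\<^sub>v z = Q *\<^sub>v a - Q *\<^sub>v (Q *\<^sub>v a)"
    unfolding z_def by (rule mult_minus_distrib_mat_vec[OF Q a Qa])
  also have "Q *\<^sub>v (Q *\<^sub>v a) = Q *\<^sub>v a" using assoc_mult_mat_vec[OF Q Q a] QQ by simp
  finally have Qz: "Q *\<^sub>v z = 0\<^sub>v n" using Qa by simp
  have "K *\<^sub>v z = K *\<^sub>v a - K *\<^sub>v (Q *\<^sub>v a)"
    unfolding z_def by (rule mult_minus_distrib_mat_vec[OF K a Qa])
  also have "K *\<^sub>v (Q *\<^sub>v a) = K *\<^sub>v a" using assoc_mult_mat_vec[OF K Q a] KQ by simp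
  finally have Kz: "K *\<^sub>v z = 0\<^sub>v n"
    using mult_mat_vec_carrier[OF K a] by (simp only: minus_cancel_vec)
  have "(A\<^sup>T *\<^sub>v z) \<bullet> (A\<^sup>T *\<^sub>v z) + l * (z \<bullet> z) = z \<bullet> (K *\<^sub>v z)"
    using ridge_quadratic_form[OF A z z] by (simp add: K_def)
  also have "\<dots> = 0" using Kz z by simp
  finally have "(A\<^sup>T *\<^sub>v z) \<bullet> (A\<^sup>T *\<^sub>v z) = 0"
    using scalar_prod_self_nonneg[of "A\<^sup>T *\<^sub>v z"] mult_nonneg_nonneg[OF l scalar_prod_self_nonneg[of z]]
    by linarith
  then have "A\<^sup>T *\<^sub>v z = 0\<^sub>v d" using scalar_prod_self_eq_0[of "A\<^sup>T *\<^sub>v z"] A by simp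
  then have "(A\<^sup>T *\<^sub>v z) $ i = 0" using i by simp
  then have az: "a \<bullet> z = 0" using A i by (simp add: a_def)
  have "(Q *\<^sub>v a) \<bullet> z = a \<bullet> (Q *\<^sub>v z)"
    using transpose_vec_mult_scalar[OF Q z a] QT by simp
  also have "\<dots> = 0" using Qz a by simp
  finally have "z \<bullet> z = 0"
    using az minus_scalar_prod_distrib[OF a Qa z] by (simp add: z_def)
  then have "z = 0\<^sub>v n" using scalar_prod_self_eq_0[of z] z by simp
  have "a = Q *\<^sub>v a"
  proof (intro eq_vecI)
    fix j assume j: "j < dim_vec (Q *\<^sub>v a)"
    then have "z $ j = 0" using \<open>z = 0\<^sub>v n\<close> Q by simp
    then show "a $ j = (Q *\<^sub>v a) $ j" using index_minus_vec(1)[OF j, of a] by (simp add: z_def)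
  qed (use a Q in simp)
  also have "\<dots> = K *\<^sub>v (pinv K *\<^sub>v a)"
    unfolding Q_def using K pK a by (rule assoc_mult_mat_vec)
  finally show ?thesis by (simp add: a_def)
qed

text \<open>The score of a column \<open>a = K y\<close> is the value of the form \<open>K\<close> at \<open>y\<close>, and \<open>a \<bullet> w\<close> is the
mixed value of the form at \<open>w\<close> and \<open>y\<close>. So the inequality is Cauchy--Schwarz for \<open>K\<close>.\<close>

lemma ridge_score_dominates:
  fixes A :: "real mat"
  assumes A: "A \<in> carrier_mat n d" and l: "0 \<le> l" and i: "i < d"
  defines "\<tau> \<equiv> col A i \<bullet> (pinv (A * A\<^sup>T + l \<cdot>\<^sub>m 1\<^sub>m n) *\<^sub>v col A i)"
  shows "0 \<le> \<tau>"
    and "w \<in> carrier_vec n \<Longrightarrow>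
      (col A i \<bullet> w)\<^sup>2 \<le> \<tau> * ((A\<^sup>T *\<^sub>v w) \<bullet> (A\<^sup>T *\<^sub>v w) + l * (w \<bullet> w))"
proof -
  define K where "K = A * A\<^sup>T + l \<cdot>\<^sub>m 1\<^sub>m n"
  define a where "a = col A i"
  define y where "y = pinv K *\<^sub>v a"
  have K: "K \<in> carrier_mat n n" using A by (simp add: K_def)
  have a: "a \<in> carrier_vec n" using A i by (simp add: a_def)
  have "pinv K \<in> carrier_mat n n" using K by (intro carrier_matI) simp_all
  then have y: "y \<in> carrier_vec n" using a by (simp add: y_def)
  have Ky: "K *\<^sub>v y = a"
    using ridge_pinv_fixes_columns[OF A l i] by (simp add: K_def y_def a_def)
  have form: "x \<bullet> (K *\<^sub>v x') = (A\<^sup>T *\<^sub>v x) \<bullet> (A\<^sup>T *\<^sub>v x') + l * (x \<bullet> x')"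
    if "x \<in> carrier_vec n" "x' \<in> carrier_vec n" for x x'
    using ridge_quadratic_form[OF A that] by (simp add: K_def)
  have psd: "0 \<le> x \<bullet> (K *\<^sub>v x)" if "x \<in> carrier_vec n" for x
    using form[OF that that] l by (simp add: scalar_prod_self_nonneg)
  have sym: "K\<^sup>T = K" unfolding K_def by (rule ridge_matrix_symmetric[OF A])
  have \<tau>: "\<tau> = y \<bullet> (K *\<^sub>v y)"
    using comm_scalar_prod[OF a y] by (simp add: Ky \<tau>_def K_def[symmetric] a_def[symmetric] y_def[symmetric])
  show "0 \<le> \<tau>" unfolding \<tau> by (rule psd[OF y])
  assume w: "w \<in> carrier_vec n"
  have "(col A i \<bullet> w)\<^sup>2 = (w \<bullet> (K *\<^sub>v y))\<^sup>2"
    using comm_scalar_prod[OF a w] by (simp add: Ky a_def[symmetric])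
  also have "\<dots> \<le> (w \<bullet> (K *\<^sub>v w)) * (y \<bullet> (K *\<^sub>v y))"
    by (rule psd_Cauchy_Schwarz[OF K sym psd w y])
  finally show "(col A i \<bullet> w)\<^sup>2 \<le> \<tau> * ((A\<^sup>T *\<^sub>v w) \<bullet> (A\<^sup>T *\<^sub>v w) + l * (w \<bullet> w))"
    unfolding \<tau> form[OF w w] by (simp add: mult.commute)
qed

text \<open>The least prefix length exists because the whole list of indices exceeds the threshold; an extension to
\<open>k\<close> indices only adds nonnegative scores.\<close>

lemma drls_selection_unselected_sum:
  assumes sel: "is_drls_selection k \<epsilon> A Ak \<Theta>" and eps: "0 < \<epsilon>"
    and nonneg: "\<And>i. i < dim_col A \<Longrightarrow> 0 \<le> ridge_leverage_score k A Ak i"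
  shows "set \<Theta> \<subseteq> {..<dim_col A}"
    and "(\<Sum>i\<in>{..<dim_col A} - set \<Theta>. ridge_leverage_score k A Ak i) \<le> \<epsilon>"
proof -
  let ?\<tau> = "ridge_leverage_score k A Ak" and ?t = "total_ridge_leverage k A Ak"
  obtain ord m where ord: "set ord = {..<dim_col A}"
    and m: "m = (LEAST m. (\<Sum>i\<in>set (take m ord). ?\<tau> i) > ?t - \<epsilon>)"
    and \<Theta>: "\<Theta> = (if m < k then take k ord else take m ord)"
    using sel unfolding is_drls_selection_def Let_def by blast
  have "(\<Sum>i\<in>set (take (length ord) ord). ?\<tau> i) > ?t - \<epsilon>"
    using ord eps by (simp add: total_ridge_leverage_def)
  then have m_sum: "(\<Sum>i\<in>set (take m ord). ?\<tau> i) > ?t - \<epsilon>"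
    unfolding m by (rule LeastI)
  show sub: "set \<Theta> \<subseteq> {..<dim_col A}"
    using \<Theta> ord set_take_subset[of k ord] set_take_subset[of m ord] by (simp split: if_splits)
  have "set (take m ord) \<subseteq> set \<Theta>"
    using \<Theta> set_take_subset_set_take[of m k ord] by simp
  then have "(\<Sum>i\<in>set (take m ord). ?\<tau> i) \<le> (\<Sum>i\<in>set \<Theta>. ?\<tau> i)"
    using sub nonneg by (intro sum_mono2) auto
  moreover have "(\<Sum>i\<in>{..<dim_col A} - set \<Theta>. ?\<tau> i) = ?t - (\<Sum>i\<in>set \<Theta>. ?\<tau> i)"
    unfolding total_ridge_leverage_def using sub by (intro sum_diff) auto
  ultimately show "(\<Sum>i\<in>{..<dim_col A} - set \<Theta>. ?\<tau> i) \<le> \<epsilon>" using m_sum by simp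
qed

text \<open>The central estimate. The residual \<open>w\<close> is orthogonal to the selected columns, so only the unselected
ones contribute to \<open>b = (A\<^sup>T w) \<bullet> (A\<^sup>T w)\<close>, and their small scores give
\<open>b \<le> \<epsilon> (b + l (w \<bullet> w))\<close>. Conversely, \<open>w\<close> is a projected image of the unit vector \<open>v\<close> under
\<open>A\<close>, so \<open>w \<bullet> w = (A\<^sup>T w) \<bullet> v\<close> and therefore \<open>(w \<bullet> w)\<^sup>2 \<le> b\<close>. Together these bound
\<open>w \<bullet> w\<close>.\<close>

lemma projection_residual_bound:
  fixes A Q :: "real mat" and \<tau> :: "nat \<Rightarrow> real"
  assumes A: "A \<in> carrier_mat n d" and l: "0 \<le> l" and eps: "0 \<le> \<epsilon>" "\<epsilon> < 1"
    and Q: "Q \<in> carrier_mat n n" "is_orth_proj Q"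
    and S: "S \<subseteq> {..<d}" "\<And>i. i \<in> S \<Longrightarrow> Q *\<^sub>v col A i = col A i"
    and dom: "\<And>i w. i < d \<Longrightarrow> w \<in> carrier_vec n \<Longrightarrow>
      (col A i \<bullet> w)\<^sup>2 \<le> \<tau> i * ((A\<^sup>T *\<^sub>v w) \<bullet> (A\<^sup>T *\<^sub>v w) + l * (w \<bullet> w))"
    and rest: "(\<Sum>i\<in>{..<d} - S. \<tau> i) \<le> \<epsilon>"
    and v: "v \<in> carrier_vec d" "v \<bullet> v = 1"
  defines "w \<equiv> A *\<^sub>v v - Q *\<^sub>v (A *\<^sub>v v)"
  shows "(1 - \<epsilon>) * (w \<bullet> w) \<le> \<epsilon> * l"
proof -
  define x where "x = A *\<^sub>v v"
  have x: "x \<in> carrier_vec n" using A v by (simp add: x_def)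
  have Qx: "Q *\<^sub>v x \<in> carrier_vec n" using Q x by simp
  have w: "w \<in> carrier_vec n" and w_eq: "w = x - Q *\<^sub>v x" using x Qx by (simp_all add: w_def x_def)
  have QT: "Q\<^sup>T = Q" and QQ: "Q * Q = Q" using Q by (auto simp: is_orth_proj_def)
  have "Q *\<^sub>v w = Q *\<^sub>v x - Q *\<^sub>v (Q *\<^sub>v x)"
    unfolding w_eq by (rule mult_minus_distrib_mat_vec[OF Q(1) x Qx])
  also have "Q *\<^sub>v (Q *\<^sub>v x) = Q *\<^sub>v x" using assoc_mult_mat_vec[OF Q(1) Q(1) x] QQ by simp
  finally have Qw: "Q *\<^sub>v w = 0\<^sub>v n" using Qx by simp
  have orth: "(Q *\<^sub>v y) \<bullet> w = 0" if "y \<in> carrier_vec n" for y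
    using transpose_vec_mult_scalar[OF Q(1) w that] QT Qw that by simp
  have Atw: "A\<^sup>T *\<^sub>v w \<in> carrier_vec d" using A w by simp
  define b where "b = (A\<^sup>T *\<^sub>v w) \<bullet> (A\<^sup>T *\<^sub>v w)"
  have b0: "0 \<le> b" by (simp add: b_def scalar_prod_self_nonneg)
  have ww0: "0 \<le> w \<bullet> w" by (rule scalar_prod_self_nonneg)
  have "b = (\<Sum>i<d. (col A i \<bullet> w)\<^sup>2)"
    using A by (simp add: b_def scalar_prod_def[of "A\<^sup>T *\<^sub>v w"] power2_eq_square atLeast0LessThan)
  also have "\<dots> = (\<Sum>i\<in>{..<d} - S. (col A i \<bullet> w)\<^sup>2)"
  proof (rule sum.mono_neutral_right)
    show "\<forall>i\<in>{..<d} - ({..<d} - S). (col A i \<bullet> w)\<^sup>2 = 0"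
    proof
      fix i assume "i \<in> {..<d} - ({..<d} - S)"
      then have i: "i \<in> S" "i < d" using S by auto
      then have "col A i \<in> carrier_vec n" using A by (intro col_carrier_vec) auto
      from orth[OF this] S(2)[OF i(1)] show "(col A i \<bullet> w)\<^sup>2 = 0" by simp
    qed
  qed auto
  also have "\<dots> \<le> (\<Sum>i\<in>{..<d} - S. \<tau> i * (b + l * (w \<bullet> w)))"
    using dom w by (intro sum_mono) (auto simp: b_def)
  also have "\<dots> = (\<Sum>i\<in>{..<d} - S. \<tau> i) * (b + l * (w \<bullet> w))" by (simp add: sum_distrib_right)
  also have "\<dots> \<le> \<epsilon> * (b + l * (w \<bullet> w))"
    using rest b0 ww0 l by (intro mult_right_mono) auto
  finally have b_le: "(1 - \<epsilon>) * b \<le> \<epsilon> * l * (w \<bullet> w)" by (simp add: algebra_simps)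
  have "w \<bullet> w = x \<bullet> w - (Q *\<^sub>v x) \<bullet> w"
    using minus_scalar_prod_distrib[OF x Qx w] by (simp add: w_eq[symmetric])
  also have "\<dots> = w \<bullet> (A *\<^sub>v v)" using orth[OF x] comm_scalar_prod[OF x w] by (simp add: x_def)
  also have "\<dots> = (A\<^sup>T *\<^sub>v w) \<bullet> v" using transpose_vec_mult_scalar[OF A v(1) w] by simp
  \<comment> \<open>The identity matrix turns \<open>psd_Cauchy_Schwarz\<close> into the ordinary Cauchy--Schwarz inequality.\<close>
  finally have "(w \<bullet> w)\<^sup>2 = ((A\<^sup>T *\<^sub>v w) \<bullet> (1\<^sub>m d *\<^sub>v v))\<^sup>2" using v by simp
  also have "\<dots> \<le> ((A\<^sup>T *\<^sub>v w) \<bullet> (1\<^sub>m d *\<^sub>v (A\<^sup>T *\<^sub>v w))) * (v \<bullet> (1\<^sub>m d *\<^sub>v v))"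
    using Atw v by (intro psd_Cauchy_Schwarz) (auto simp: scalar_prod_self_nonneg)
  also have "\<dots> = b" using Atw v by (simp add: b_def)
  finally have "(w \<bullet> w)\<^sup>2 \<le> b" .
  then have "(1 - \<epsilon>) * (w \<bullet> w)\<^sup>2 \<le> (1 - \<epsilon>) * b" using eps by (intro mult_left_mono) auto
  with b_le have le: "(w \<bullet> w) * ((1 - \<epsilon>) * (w \<bullet> w)) \<le> (w \<bullet> w) * (\<epsilon> * l)"
    by (simp add: power2_eq_square mult_ac)
  show ?thesis
  proof (cases "w \<bullet> w = 0")
    case False
    then show ?thesis using le ww0 by simp
  next
    case True
    then show ?thesis using eps l by simp
  qed
qed

section \<open>Rank-\<open>k\<close> approximation inside the column space\<close>

lemma svd_trunc_rank_le:
  fixes M :: "real mat"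
  assumes "H \<in> carrier_mat d k" "M \<in> carrier_mat n d"
  shows "vec_space.rank n (M * H * H\<^sup>T) \<le> k"
  using assms by (intro rank_mult_le_dim_col[of "M * H" n k "H\<^sup>T" d]) auto

lemma low_rank_in_colspaceI:
  assumes A: "A \<in> carrier_mat n d" and C: "C \<in> carrier_mat n c" and Y: "Y \<in> carrier_mat c d"
    and rank: "vec_space.rank n (C * Y) \<le> k"
  shows "C * Y \<in> low_rank_in_colspace k A C"
proof -
  have "col (C * Y) j = C *\<^sub>v col Y j" "col Y j \<in> carrier_vec c" if "j < d" for j
    using that C Y col_mult2[OF C Y] by auto
  then show ?thesis using A C Y rank by (auto simp: low_rank_in_colspace_def)
qed

lemma orth_proj_fixes_low_rank_in_colspace:
  assumes A: "A \<in> carrier_mat n d" and C: "C \<in> carrier_mat n c"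
    and Q: "Q \<in> carrier_mat n n" "Q * C = C" and X: "X \<in> low_rank_in_colspace k A C"
  shows "Q * X = X"
proof (rule mat_col_eqI)
  have Xc: "X \<in> carrier_mat n d" using A X by (simp add: low_rank_in_colspace_def)
  show "dim_row (Q * X) = dim_row X" "dim_col (Q * X) = dim_col X" using Q Xc by auto
  fix j assume "j < dim_col X"
  then have j: "j < d" using Xc by simp
  then obtain w where w: "w \<in> carrier_vec c" "col X j = C *\<^sub>v w"
    using X A C by (auto simp: low_rank_in_colspace_def)
  have "col (Q * X) j = Q *\<^sub>v (C *\<^sub>v w)" using col_mult2[OF Q(1) Xc j] w(2) by simp
  also have "\<dots> = C *\<^sub>v w" using assoc_mult_mat_vec[OF Q(1) C w(1)] Q(2) by simp
  finally show "col (Q * X) j = col X j" using w(2) by simp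
qed

text \<open>For every \<open>X\<close> with columns in the column space of \<open>C\<close>, the error splits by Pythagoras into the fixed
part \<open>A - Q A\<close> and the distance from \<open>X\<close> to \<open>Q A\<close>, where \<open>Q = C (pinv C)\<close>; the latter is
minimized by a truncation of \<open>Q A\<close> according to Eckart--Young.\<close>

lemma best_frob_approx_in_colspace:
  assumes A: "A \<in> carrier_mat n d" and C: "C \<in> carrier_mat n c" and k: "k \<le> d"
    and P: "is_svd_trunc k (C * pinv C * A) P"
  shows "is_best_frob_approx_in_colspace k A C P"
    and "frob_sq (A - C * pinv C * A) \<le> frob_sq (A - P)"
proof -
  define Q where "Q = C * pinv C"
  have pC: "pinv C \<in> carrier_mat c n" using C by (intro carrier_matI) auto
  have Q: "Q \<in> carrier_mat n n" unfolding Q_def using C pC by (rule mult_carrier_mat)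
  have proj: "is_orth_proj Q" and QC: "Q * C = C"
    unfolding Q_def by (rule orth_proj_mult_pinv, rule mult_pinv_mult)
  have QA: "Q * A \<in> carrier_mat n d" using Q A by (rule mult_carrier_mat)
  have P': "is_svd_trunc k (Q * A) P" using P by (simp only: Q_def)
  obtain H where H: "H \<in> carrier_mat d k" and PH: "P = Q * A * H * H\<^sup>T"
    using svd_trunc_right_projection[OF P'] QA k by (metis carrier_matD(2))
  have PC: "P = C * (pinv C * A * H * H\<^sup>T)"
    unfolding PH Q_def using A C H by (simp add: mult_assoc_dim)
  have "vec_space.rank n P \<le> k" unfolding PH by (rule svd_trunc_rank_le[OF H QA])
  moreover have Y: "pinv C * A * H * H\<^sup>T \<in> carrier_mat c d"
    using pC A H by (intro mult_carrier_mat[of _ c k] mult_carrier_mat[of _ c d]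
      mult_carrier_mat[of _ c n]) auto
  ultimately have low: "P \<in> low_rank_in_colspace k A C"
    unfolding PC by (intro low_rank_in_colspaceI[OF A C])
  have split: "frob_sq (A - X) = frob_sq (A - Q * A) + frob_sq (Q * A - X)"
    if "X \<in> low_rank_in_colspace k A C" for X
    using that A Q orth_proj_fixes_low_rank_in_colspace[OF A C Q QC that] proj
    by (intro orth_proj_Pythagoras) (auto simp: low_rank_in_colspace_def)
  have min: "frob_sq (A - P) \<le> frob_sq (A - X)" if X: "X \<in> low_rank_in_colspace k A C" for X
  proof -
    have "frob_sq (Q * A - P) \<le> frob_sq (Q * A - X)"
      using X A Q by (intro Eckart_Young_frob[OF P']) (auto simp: low_rank_in_colspace_def)
    then show ?thesis using split[OF X] split[OF low] by simp
  qed
  have "frob_norm (A - P) \<le> frob_norm (A - X)" if "X \<in> low_rank_in_colspace k A C" for X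
    by (rule power2_le_imp_le) (use min[OF that] in \<open>simp_all add: frob_norm_power2 frob_norm_nonneg\<close>)
  then show "is_best_frob_approx_in_colspace k A C P"
    using low unfolding is_best_frob_approx_in_colspace_def is_arg_min_def
    by (auto simp: not_less)
  show "frob_sq (A - C * pinv C * A) \<le> frob_sq (A - P)"
    using split[OF low] frob_sq_nonneg[of "Q * A - P"] by (simp add: Q_def)
qed

text \<open>The rows of \<open>A - Ak\<close> are orthogonal to the columns of \<open>H\<close>, whereas the rows of
\<open>Ak - Q Ak\<close> are combinations of them. So the two errors are orthogonal, and the second is
measured on the \<open>k\<close> orthonormal directions given by \<open>H\<close>.\<close>

lemma projected_svd_trunc_error:
  assumes A: "A \<in> carrier_mat n d" and Ak: "Ak = A * H * H\<^sup>T"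
    and H: "H \<in> carrier_mat d k" "H\<^sup>T * H = 1\<^sub>m k" and Q: "Q \<in> carrier_mat n n"
  shows "frob_sq (A - Q * Ak) = frob_sq (A - Ak) +
    (\<Sum>j<k. (A *\<^sub>v col H j - Q *\<^sub>v (A *\<^sub>v col H j)) \<bullet> (A *\<^sub>v col H j - Q *\<^sub>v (A *\<^sub>v col H j)))"
proof -
  have dims [simp]: "dim_row A = n" "dim_col A = d" "dim_row H = d" "dim_col H = k"
    "dim_row Q = n" "dim_col Q = n"
    using A H Q by auto
  have AH: "A * H \<in> carrier_mat n k" using A H by simp
  have QAH: "Q * (A * H) \<in> carrier_mat n k" using Q AH by simp
  have HT: "H\<^sup>T \<in> carrier_mat k d" using H by simp
  have Akc: "Ak \<in> carrier_mat n d" unfolding Ak using AH HT by (rule mult_carrier_mat)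
  define Z where "Z = A * H - Q * (A * H)"
  have Z: "Z \<in> carrier_mat n k" using AH QAH unfolding Z_def by (intro minus_carrier_mat)
  have "Ak - Q * Ak = A * H * H\<^sup>T - Q * (A * H) * H\<^sup>T"
    unfolding Ak using mult_assoc_dim[of Q "A * H" "H\<^sup>T"] by simp
  also have "\<dots> = Z * H\<^sup>T"
    unfolding Z_def by (rule minus_mult_distrib_mat[OF AH QAH HT, symmetric])
  finally have ZH: "Ak - Q * Ak = Z * H\<^sup>T" .
  have "(A - Ak) * H = A * H - Ak * H" by (rule minus_mult_distrib_mat[OF A Akc H(1)])
  also have "Ak * H = A * H * (H\<^sup>T * H)" unfolding Ak by (rule mult_assoc_dim) simp_all
  also have "\<dots> = A * H" using AH by (simp add: H(2))
  finally have AkH: "(A - Ak) * H = 0\<^sub>m n k" using AH by simp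
  have [simp]: "dim_row Ak = n" "dim_col Ak = d" "dim_row Z = n" "dim_col Z = k"
    using Akc Z by auto
  have "frob_ip (A - Ak) (Z * H\<^sup>T) = frob_ip (Z * H\<^sup>T) (A - Ak)" by (rule frob_ip_commute) simp_all
  also have "\<dots> = frob_ip Z ((A - Ak) * H)" by (subst frob_ip_mult_right) simp_all
  also have "\<dots> = 0" unfolding AkH by (simp add: frob_ip_def)
  finally have orth: "frob_ip (A - Ak) (Z * H\<^sup>T) = 0" .
  have "A - Q * Ak = (A - Ak) + (Ak - Q * Ak)" by (intro eq_matI) auto
  then have "frob_sq (A - Q * Ak) = frob_sq (A - Ak) + frob_sq (Z * H\<^sup>T)"
    unfolding ZH using orth by (simp add: frob_sq_add)
  also have "frob_sq (Z * H\<^sup>T) = frob_sq Z" using H by (intro frob_sq_isometry_right) auto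
  also have "\<dots> = (\<Sum>j<k. col Z j \<bullet> col Z j)" by (simp add: frob_sq_cols)
  also have "\<dots> = (\<Sum>j<k. (A *\<^sub>v col H j - Q *\<^sub>v (A *\<^sub>v col H j)) \<bullet>
      (A *\<^sub>v col H j - Q *\<^sub>v (A *\<^sub>v col H j)))"
  proof (rule sum.cong)
    fix j assume "j \<in> {..<k}"
    then have j: "j < k" by simp
    have "col Z j = col (A * H) j - col (Q * (A * H)) j"
      using j unfolding Z_def by (intro eq_vecI) auto
    then show "col Z j \<bullet> col Z j = (A *\<^sub>v col H j - Q *\<^sub>v (A *\<^sub>v col H j)) \<bullet>
        (A *\<^sub>v col H j - Q *\<^sub>v (A *\<^sub>v col H j))"
      by (simp only: col_mult2[OF Q AH j] col_mult2[OF A H(1) j])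
  qed simp
  finally show ?thesis .
qed

section \<open>The error bound\<close>

theorem theorem2:
  fixes A Ak C P :: "real mat" and n d k :: nat and \<epsilon> :: real
  assumes "A \<in> carrier_mat n d"
    and "1 \<le> k" and "k \<le> vec_space.rank n A"
    and "0 < \<epsilon>" and "\<epsilon> < 1 / 4"
    and "is_svd_trunc k A Ak"
    and "is_drls_output k \<epsilon> A Ak C"
    and "is_svd_trunc k (C * pinv C * A) P"
  shows "is_best_frob_approx_in_colspace k A C P \<and>
         (frob_norm (A - C * pinv C * A))\<^sup>2 \<le> (frob_norm (A - P))\<^sup>2 \<and>
         (frob_norm (A - P))\<^sup>2 \<le> (1 + 4 * \<epsilon>) * (frob_norm (A - Ak))\<^sup>2"
proof -
  note A = assms(1) and eps = assms(4,5)
  have [simp]: "dim_row A = n" "dim_col A = d" using A by auto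
  have kd: "k \<le> d" using assms(3) vec_space.rank_le_nc[OF A] by simp
  obtain \<Theta> where sel: "is_drls_selection k \<epsilon> A Ak \<Theta>" and C_def: "C = mat_of_cols n (map (col A) \<Theta>)"
    using assms(7) by (auto simp: is_drls_output_def)
  have C: "C \<in> carrier_mat n (length \<Theta>)" unfolding C_def by (intro carrier_matI) simp_all
  note best = best_frob_approx_in_colspace[OF A C kd assms(8)]
  \<comment> \<open>The scores use a ridge parameter \<open>l\<close> with \<open>k l\<close> equal to the squared error of \<open>Ak\<close>, so a
    residual of order \<open>\<epsilon> l\<close> in each of \<open>k\<close> directions is affordable.\<close>
  define l where "l = 1 / real k * (frob_norm (A - Ak))\<^sup>2"
  have l: "0 \<le> l" by (simp add: l_def)
  have kl: "real k * l = frob_sq (A - Ak)" using assms(2) by (simp add: l_def frob_norm_power2)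
  have score: "ridge_leverage_score k A Ak i =
      col A i \<bullet> (pinv (A * A\<^sup>T + l \<cdot>\<^sub>m 1\<^sub>m n) *\<^sub>v col A i)" for i
    by (simp add: ridge_leverage_score_def l_def)
  note dom = ridge_score_dominates[OF A l, folded score]
  have \<Theta>_sub: "set \<Theta> \<subseteq> {..<d}"
    and \<Theta>_sum: "(\<Sum>i\<in>{..<d} - set \<Theta>. ridge_leverage_score k A Ak i) \<le> \<epsilon>"
    using drls_selection_unselected_sum[OF sel eps(1)] dom(1) by simp_all
  define Q where "Q = C * pinv C"
  have pC: "pinv C \<in> carrier_mat (length \<Theta>) n" using C by (intro carrier_matI) auto
  have Q: "Q \<in> carrier_mat n n" unfolding Q_def using C pC by (rule mult_carrier_mat)
  have proj: "is_orth_proj Q" and QC: "Q * C = C"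
    unfolding Q_def by (rule orth_proj_mult_pinv, rule mult_pinv_mult)
  have fixed: "Q *\<^sub>v col A i = col A i" if i: "i \<in> set \<Theta>" for i
  proof -
    obtain j where j: "j < length \<Theta>" "\<Theta> ! j = i" using i by (auto simp: in_set_conv_nth)
    have "i < d" using i \<Theta>_sub by auto
    then have "col A i \<in> carrier_vec n" using A by (intro col_carrier_vec) auto
    then have "col C j = col A i" using j unfolding C_def by (subst col_mat_of_cols) auto
    then show ?thesis using col_mult2[OF Q C j(1)] QC by simp
  qed
  obtain H where H: "H \<in> carrier_mat d k" "H\<^sup>T * H = 1\<^sub>m k" and Ak: "Ak = A * H * H\<^sup>T"
    using svd_trunc_right_projection[OF assms(6)] kd by auto
  define r where "r j = A *\<^sub>v col H j - Q *\<^sub>v (A *\<^sub>v col H j)" for j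
  have "(1 - \<epsilon>) * (r j \<bullet> r j) \<le> \<epsilon> * l" if j: "j < k" for j
  proof -
    have "col H j \<bullet> col H j = (H\<^sup>T * H) $$ (j, j)" using H(1) j by (simp)
    also have "\<dots> = 1" using H(2) j by simp
    finally have unit: "col H j \<bullet> col H j = 1" .
    have "col H j \<in> carrier_vec d" using H(1) j by (intro col_carrier_vec) auto
    from projection_residual_bound[OF A l _ _ Q proj \<Theta>_sub fixed dom(2) \<Theta>_sum this unit]
    show ?thesis using eps by (simp add: r_def)
  qed
  then have "(\<Sum>j<k. (1 - \<epsilon>) * (r j \<bullet> r j)) \<le> (\<Sum>j<k. \<epsilon> * l)" by (intro sum_mono) auto
  also have "\<dots> = \<epsilon> * frob_sq (A - Ak)" using kl by (simp add: mult.left_commute)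
  finally have res: "(1 - \<epsilon>) * (\<Sum>j<k. r j \<bullet> r j) \<le> \<epsilon> * frob_sq (A - Ak)"
    by (simp add: sum_distrib_left)
  have sum0: "0 \<le> (\<Sum>j<k. r j \<bullet> r j)" by (intro sum_nonneg scalar_prod_self_nonneg)
  \<comment> \<open>Since \<open>\<epsilon> < 1/4\<close>, the factor \<open>1 - \<epsilon>\<close> exceeds \<open>1/4\<close>.\<close>
  have "1 / 4 * (\<Sum>j<k. r j \<bullet> r j) \<le> (1 - \<epsilon>) * (\<Sum>j<k. r j \<bullet> r j)"
    using eps sum0 by (intro mult_right_mono) auto
  with res have res': "(\<Sum>j<k. r j \<bullet> r j) \<le> 4 * \<epsilon> * frob_sq (A - Ak)" by simp
  have low: "Q * Ak \<in> low_rank_in_colspace k A C"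
  proof -
    have QAk: "Q * Ak = Q * A * H * H\<^sup>T"
      unfolding Ak using A H(1) Q by (simp add: mult_assoc_dim)
    have QA: "Q * A \<in> carrier_mat n d" using Q A by (rule mult_carrier_mat)
    have Akc: "Ak \<in> carrier_mat n d" unfolding Ak using A H(1) by (intro carrier_matI) auto
    have "Q * Ak = C * (pinv C * Ak)"
      unfolding Q_def using C Akc by (intro mult_assoc_dim) auto
    moreover have "vec_space.rank n (Q * Ak) \<le> k"
      unfolding QAk by (rule svd_trunc_rank_le[OF H(1) QA])
    ultimately show ?thesis
      using low_rank_in_colspaceI[OF A C mult_carrier_mat[OF pC Akc]] by simp
  qed
  have "\<not> frob_norm (A - Q * Ak) < frob_norm (A - P)"
    using best(1) low unfolding is_best_frob_approx_in_colspace_def is_arg_min_def by blast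
  then have "(frob_norm (A - P))\<^sup>2 \<le> (frob_norm (A - Q * Ak))\<^sup>2"
    by (intro power_mono frob_norm_nonneg) (simp only: not_less)
  also have "\<dots> = frob_sq (A - Ak) + (\<Sum>j<k. r j \<bullet> r j)"
    using projected_svd_trunc_error[OF A Ak H Q] by (simp add: frob_norm_power2 r_def)
  also have "\<dots> \<le> (1 + 4 * \<epsilon>) * (frob_norm (A - Ak))\<^sup>2"
    using res' by (simp add: frob_norm_power2 algebra_simps)
  finally show ?thesis using best by (simp add: frob_norm_power2)
qed

end
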